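(* Let $G=(V,E)$ be a simple graph, and let $A_1, A_2 \subseteq E$ be triangle-free 2-matchings in $G$. Then there is a partition $\mathcal{P}$ of $A_1 \bigtriangleup A_2$ into alternating trails with respect to $(A_1, A_2)$ such that $A_i \bigtriangleup P$ is a triangle-free 2-matching for $i=1,2$ and for every $P \in \mathcal{P}$.
   Context: A (simple) 2-matching in $G=(V,E)$ is an edge set $M\subseteq E$ such that every vertex is incident to at most $2$ edges of $M$. A triangle is an edge set forming a cycle of length $3$; a 2-matching is triangle-free if it contains no triangle as a subset. A trail is a sequence of distinct consecutive edges $u_1u_2, u_2u_3, \dots, u_ku_{k+1}$ (the vertices $u_j$ need not be distinct); a trail is identified with its set of edges when convenient. For 2-matchings $A_1, A_2$, a trail is alternating with respect to $(A_1,A_2)$ if it traverses edges of $A_1\setminus A_2$ and $A_2\setminus A_1$ alternately. $\bigtriangleup$ denotes symmetric difference. *)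

theory Defs
  imports "HOL-Library.Disjoint_Sets"
begin

(* Graphs are finite: an alternating trail is a finite sequence, and on infinite graphs
   (e.g. the 4-regular tree) the decomposition need not exist. *)
definition simple_graph :: "'a set \<Rightarrow> 'a set set \<Rightarrow> bool" where
  "simple_graph V E \<longleftrightarrow> finite V \<and> E \<subseteq> {{u, v} | u v. u \<in> V \<and> v \<in> V \<and> u \<noteq> v}"

definition two_matching :: "'a set \<Rightarrow> 'a set set \<Rightarrow> 'a set set \<Rightarrow> bool" where
  "two_matching V E M \<longleftrightarrow> M \<subseteq> E \<and> (\<forall>v\<in>V. card {e \<in> M. v \<in> e} \<le> 2)"

definition is_triangle :: "'a set set \<Rightarrow> bool" where
  "is_triangle T \<longleftrightarrow> (\<exists>u v w. distinct [u, v, w] \<and> T = {{u, v}, {v, w}, {w, u}})"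

definition triangle_free :: "'a set set \<Rightarrow> bool" where
  "triangle_free M \<longleftrightarrow> \<not> (\<exists>T. is_triangle T \<and> T \<subseteq> M)"

definition walk_edges :: "'a list \<Rightarrow> 'a set list" where
  "walk_edges us = map (\<lambda>(u, v). {u, v}) (zip us (tl us))"

definition is_trail :: "'a set set \<Rightarrow> 'a list \<Rightarrow> bool" where
  "is_trail E us \<longleftrightarrow>
     length us \<ge> 2 \<and> set (walk_edges us) \<subseteq> E \<and> distinct (walk_edges us)"

(* The alternation condition is not cyclic: on a closed trail the last and the first edge
   may lie in the same one of the two matchings. *)
definition alternating_trail ::
    "'a set set \<Rightarrow> 'a set set \<Rightarrow> 'a set set \<Rightarrow> 'a list \<Rightarrow> bool" where
  "alternating_trail E A\<^sub>1 A\<^sub>2 us \<longleftrightarrow>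
     is_trail E us \<and>
     set (walk_edges us) \<subseteq> sym_diff A\<^sub>1 A\<^sub>2 \<and>
     (\<forall>i. Suc i < length (walk_edges us) \<longrightarrow>
        (walk_edges us ! i \<in> A\<^sub>1 - A\<^sub>2 \<and> walk_edges us ! Suc i \<in> A\<^sub>2 - A\<^sub>1) \<or>
        (walk_edges us ! i \<in> A\<^sub>2 - A\<^sub>1 \<and> walk_edges us ! Suc i \<in> A\<^sub>1 - A\<^sub>2))"

end

theory Submission
  imports Defs
begin

text \<open>
  Colour the edges of \<open>A\<^sub>1 - A\<^sub>2\<close> red and those of \<open>A\<^sub>2 - A\<^sub>1\<close> blue, and choose at every vertex
  a maximal matching between the red and the blue edges there. The classes of edges connected by
  these transitions are alternating trails, and switching one of them keeps both sets 2-matchings,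
  because the local matchings are maximum. No triangle arises as soon as every triangle with both a
  red and a blue edge has such a pair in one trail; this holds if two of its edges are matched at
  their common vertex (the triangle is then good). A vertex with two different maximum matchings can
  be flipped from one to the other. Flipping a corner of a bad triangle makes it good, and at most
  two triangles sharing an edge with it become bad. Following these, a case analysis shows that at
  most four flips enlarge the set of good triangles, unless the bad triangle lies in a cluster: a
  \<open>K\<^sub>5\<close> minus at most one edge in which one colour contains a path with four edges and the other a
  5-cycle. So choose the matchings with as many good triangles as possible. A triangle meeting a
  cluster lies in it, hence clusters are disjoint, and the matchings can be redefined on each of them
  separately, such that all coloured edges of the cluster belong to a single trail.
\<close>

section \<open>Pairs of triangle-free 2-matchings\<close>

locale triangle_free_2_matching =
  fixes M :: "'a \<Rightarrow> 'a \<Rightarrow> bool"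
  assumes adj_sym: "M x y \<Longrightarrow> M y x"
    and degree: "\<lbrakk>M x a; M x b; M x c\<rbrakk> \<Longrightarrow> a = b \<or> a = c \<or> b = c"
    and no_triangle: "\<lbrakk>M x y; M y z\<rbrakk> \<Longrightarrow> \<not> M x z"
begin

lemma irrefl: "\<not> M x x"
  using no_triangle by blast

end

definition exclusive :: "('a \<Rightarrow> 'a \<Rightarrow> bool) \<Rightarrow> ('a \<Rightarrow> 'a \<Rightarrow> bool) \<Rightarrow> 'a \<Rightarrow> 'a \<Rightarrow> bool" where
  "exclusive M N x y \<longleftrightarrow> M x y \<and> \<not> N x y"

locale matching_pair =
  M: triangle_free_2_matching M + N: triangle_free_2_matching N for M N :: "'a \<Rightarrow> 'a \<Rightarrow> bool"
begin

lemma matching_pair_commute: "matching_pair N M"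
  by unfold_locales

abbreviation red :: "'a \<Rightarrow> 'a \<Rightarrow> bool" where
  "red \<equiv> exclusive M N"

abbreviation blue :: "'a \<Rightarrow> 'a \<Rightarrow> bool" where
  "blue \<equiv> exclusive N M"

definition edge :: "'a \<Rightarrow> 'a \<Rightarrow> bool" where
  "edge x y \<longleftrightarrow> M x y \<or> N x y"

definition opposite :: "'a \<Rightarrow> 'a \<Rightarrow> 'a \<Rightarrow> bool" where
  "opposite u a b \<longleftrightarrow> red u a \<and> blue u b \<or> blue u a \<and> red u b"

lemma red_sym: "red x y \<Longrightarrow> red y x"
  unfolding exclusive_def using M.adj_sym N.adj_sym by blast

lemma blue_sym: "blue x y \<Longrightarrow> blue y x"
  unfolding exclusive_def using M.adj_sym N.adj_sym by blast

lemma edge_sym: "edge x y \<Longrightarrow> edge y x"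
  unfolding edge_def using M.adj_sym N.adj_sym by blast

lemma red_not_blue: "red x y \<Longrightarrow> \<not> blue x y"
  unfolding exclusive_def by blast

lemma red_neq: "red x y \<Longrightarrow> x \<noteq> y"
  unfolding exclusive_def using M.irrefl by blast

lemma blue_neq: "blue x y \<Longrightarrow> x \<noteq> y"
  unfolding exclusive_def using N.irrefl by blast

lemma edge_neq: "edge x y \<Longrightarrow> x \<noteq> y"
  unfolding edge_def using M.irrefl N.irrefl by blast

lemma red_edge: "red x y \<Longrightarrow> edge x y"
  and blue_edge: "blue x y \<Longrightarrow> edge x y"
  unfolding exclusive_def edge_def by blast+

lemma red_degree: "\<lbrakk>red v a; red v b; a \<noteq> b; red v y\<rbrakk> \<Longrightarrow> y = a \<or> y = b"
  unfolding exclusive_def using M.degree[of v a b y] by blast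

lemma blue_degree: "\<lbrakk>blue v a; blue v b; a \<noteq> b; blue v y\<rbrakk> \<Longrightarrow> y = a \<or> y = b"
  unfolding exclusive_def using N.degree[of v a b y] by blast

lemma red_saturated: "\<lbrakk>red v a; red v b; a \<noteq> b; edge v y\<rbrakk> \<Longrightarrow> y = a \<or> y = b \<or> blue v y"
  unfolding exclusive_def edge_def using M.degree[of v a b y] by blast

lemma blue_saturated: "\<lbrakk>blue v a; blue v b; a \<noteq> b; edge v y\<rbrakk> \<Longrightarrow> y = a \<or> y = b \<or> red v y"
  unfolding exclusive_def edge_def using N.degree[of v a b y] by blast

lemma opposite_sym: "opposite u a b \<Longrightarrow> opposite u b a"
  unfolding opposite_def by blast

lemma opposite_distinct: "opposite u a b \<Longrightarrow> distinct [u, a, b]"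
  unfolding opposite_def using red_neq blue_neq red_not_blue by auto

lemma opposite_edge: "opposite u a b \<Longrightarrow> edge u a"
  unfolding opposite_def using red_edge blue_edge by blast

lemma opposite_degree:
  "\<lbrakk>opposite u a b; opposite u a b'; opposite u a b''\<rbrakk> \<Longrightarrow> b = b' \<or> b = b'' \<or> b' = b''"
  unfolding opposite_def using red_degree[of u b b' b''] blue_degree[of u b b' b''] red_not_blue
  by blast

lemma opposite_trans3: "\<lbrakk>opposite u a b; opposite u b c; opposite u c d\<rbrakk> \<Longrightarrow> opposite u a d"
  unfolding opposite_def using red_not_blue by blast

lemma opposite_either: "\<lbrakk>opposite u a b; opposite u c d\<rbrakk> \<Longrightarrow> opposite u a c \<or> opposite u a d"
  unfolding opposite_def by blast

lemma opposite_cases: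
  assumes "opposite u a b" "edge a b"
  obtains (common) "M a b" "N a b" | (first) "opposite a u b" | (second) "opposite b u a"
  using assms red_sym blue_sym M.adj_sym N.adj_sym unfolding opposite_def edge_def exclusive_def
  by metis

definition coloured :: "'a set \<Rightarrow> 'a set set" where
  "coloured K = {{x, y} | x y. x \<in> K \<and> y \<in> K \<and> (red x y \<or> blue x y)}"

lemma colouredI: "\<lbrakk>x \<in> K; y \<in> K; red x y \<or> blue x y\<rbrakk> \<Longrightarrow> {x, y} \<in> coloured K"
  unfolding coloured_def by blast

lemma colouredE:
  assumes "e \<in> coloured K"
  obtains x y where "e = {x, y}" "x \<in> K" "y \<in> K" "red x y \<or> blue x y"
  using assms unfolding coloured_def by blast

lemma coloured_colour: "{x, y} \<in> coloured K \<Longrightarrow> red x y \<or> blue x y"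
  by (elim colouredE) (auto simp: doubleton_eq_iff intro: red_sym blue_sym)

section \<open>Transition systems\<close>

text \<open>Every maximal matching of a complete bipartite graph is a maximum one.\<close>

definition transitions_at :: "'a \<Rightarrow> ('a \<Rightarrow> 'a \<Rightarrow> bool) \<Rightarrow> bool" where
  "transitions_at u m \<longleftrightarrow>
     (\<forall>a b. m a b \<longrightarrow> opposite u a b \<and> m b a) \<and>
     (\<forall>a b b'. m a b \<longrightarrow> m a b' \<longrightarrow> b = b') \<and>
     (\<forall>a b. opposite u a b \<longrightarrow> (\<exists>c. m a c \<or> m b c))"

definition transition_system :: "('a \<Rightarrow> 'a \<Rightarrow> 'a \<Rightarrow> bool) \<Rightarrow> bool" where
  "transition_system q \<longleftrightarrow> (\<forall>u. transitions_at u (q u))"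

lemma transition_systemD: "transition_system q \<Longrightarrow> transitions_at u (q u)"
  unfolding transition_system_def by blast

context
  fixes u m
  assumes m: "transitions_at u m"
begin

lemma transition_opposite: "m a b \<Longrightarrow> opposite u a b"
  using m unfolding transitions_at_def by blast

lemma transition_sym: "m a b \<Longrightarrow> m b a"
  using m unfolding transitions_at_def by blast

lemma transition_unique: "\<lbrakk>m a b; m a b'\<rbrakk> \<Longrightarrow> b = b'"
  using m unfolding transitions_at_def by blast

lemma transition_maximal:
  assumes "opposite u a b"
  obtains (left) c where "m a c" | (right) c where "m b c"
  using m assms unfolding transitions_at_def by blast

lemma transition_forced:
  assumes "opposite u a b" "\<And>c. opposite u a c \<Longrightarrow> c = b" "\<And>c. opposite u b c \<Longrightarrow> c = a"
  shows "m a b"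
  using transition_maximal[OF assms(1)] assms(2,3) transition_opposite transition_sym by metis

lemma transition_complement:
  assumes "opposite u a b" "opposite u a b'" "b \<noteq> b'"
  shows "m a b \<longleftrightarrow> \<not> m a b'"
proof
  show "m a b \<Longrightarrow> \<not> m a b'" using transition_unique assms(3) by blast
  assume unmatched: "\<not> m a b'"
  from assms(2) show "m a b"
  proof (cases rule: transition_maximal)
    case (left c)
    then show ?thesis
      using opposite_degree[OF assms(1,2), of c] transition_opposite assms(3) unmatched by blast
  next
    case b': (right c)
    from assms(1) show ?thesis
    proof (cases rule: transition_maximal)
      case (left d)
      then show ?thesis
        using opposite_degree[OF assms(1,2), of d] transition_opposite assms(3) unmatched by blast
    next
      case b: (right d)
      have "opposite u b' a" "opposite u b' c" "opposite u b' d"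
        using assms b' b transition_opposite opposite_sym opposite_trans3 by blast+
      then have "a = c \<or> a = d \<or> c = d" by (rule opposite_degree)
      then show ?thesis using b b' transition_sym transition_unique unmatched assms(3) by blast
    qed
  qed
qed

lemma transitions_at_complement:
  assumes "opposite u a b" "\<not> m a b"
  shows "transitions_at u (\<lambda>c d. opposite u c d \<and> \<not> m c d)"
  unfolding transitions_at_def
proof (intro conjI allI impI)
  fix c d d'
  assume "opposite u c d \<and> \<not> m c d" "opposite u c d' \<and> \<not> m c d'"
  then show "d = d'" using transition_complement by blast
next
  fix c d assume cd: "opposite u c d"
  show "\<exists>e. opposite u c e \<and> \<not> m c e \<or> opposite u d e \<and> \<not> m d e"
  proof (rule ccontr)
    assume "\<nexists>e. opposite u c e \<and> \<not> m c e \<or> opposite u d e \<and> \<not> m d e"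
    then have matched: "opposite u c e \<Longrightarrow> m c e" "opposite u d e \<Longrightarrow> m d e" for e
      by blast+
    have "opposite u a c \<or> opposite u a d" using opposite_either[OF assms(1) cd] .
    then show False
      using matched cd assms opposite_sym opposite_trans3 transition_sym transition_unique by metis
  qed
qed (use transition_sym opposite_sym in blast)+

end

definition through :: "'a \<Rightarrow> 'a \<Rightarrow> 'a \<Rightarrow> 'a \<Rightarrow> 'a \<Rightarrow> bool" where
  "through u x y a b \<longleftrightarrow> opposite u a b \<and> (a \<in> {x, y} \<longleftrightarrow> b \<in> {x, y})"

lemma transitions_at_through:
  assumes "opposite u x y"
  shows "transitions_at u (through u x y)"
  unfolding transitions_at_def
proof (intro conjI allI impI)
  fix a b b' assume "through u x y a b" "through u x y a b'"
  then show "b = b'"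
    unfolding through_def opposite_def
    using assms[unfolded opposite_def] red_degree[of u b b'] blue_degree[of u b b'] red_not_blue
    by blast
next
  fix a b assume "opposite u a b"
  then show "\<exists>c. through u x y a c \<or> through u x y b c"
    unfolding through_def using assms opposite_sym opposite_either by blast
qed (auto simp: through_def dest: opposite_sym)

lemma transition_system_exists: "\<exists>q. transition_system q"
proof -
  have "\<exists>m. transitions_at u m" for u
  proof (cases "\<exists>x y. opposite u x y")
    case True
    then show ?thesis using transitions_at_through by blast
  next
    case False
    then have "transitions_at u (\<lambda>a b. False)" unfolding transitions_at_def by blast
    then show ?thesis by blast
  qed
  then show ?thesis unfolding transition_system_def by metis
qed

definition flip :: "'a \<Rightarrow> ('a \<Rightarrow> 'a \<Rightarrow> 'a \<Rightarrow> bool) \<Rightarrow> 'a \<Rightarrow> 'a \<Rightarrow> 'a \<Rightarrow> bool" where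
  "flip u q = q(u := \<lambda>a b. opposite u a b \<and> \<not> q u a b)"

lemma flip_same: "flip u q u a b \<longleftrightarrow> opposite u a b \<and> \<not> q u a b"
  by (simp add: flip_def)

lemma flip_other: "v \<noteq> u \<Longrightarrow> flip u q v = q v"
  by (simp add: flip_def)

lemma transition_system_flip:
  assumes "transition_system q" "opposite u a b" "\<not> q u a b"
  shows "transition_system (flip u q)"
  using assms transitions_at_complement by (auto simp: transition_system_def flip_def)

end

section \<open>Good and bad triangles\<close>

definition good :: "('a \<Rightarrow> 'a \<Rightarrow> 'a \<Rightarrow> bool) \<Rightarrow> 'a set \<Rightarrow> bool" where
  "good q T \<longleftrightarrow> (\<exists>u a b. T = {u, a, b} \<and> q u a b)"

lemma goodI: "q u a b \<Longrightarrow> good q {u, a, b}"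
  unfolding good_def by blast

context matching_pair
begin

definition mixed :: "'a set \<Rightarrow> bool" where
  "mixed T \<longleftrightarrow> (\<exists>u a b. T = {u, a, b} \<and> opposite u a b \<and> edge a b)"

lemma mixedI: "\<lbrakk>opposite u a b; edge a b\<rbrakk> \<Longrightarrow> mixed {u, a, b}"
  unfolding mixed_def by blast

lemma mixed_triangle:
  assumes "edge x y" "edge y z" "edge x z"
  shows "mixed {x, y, z}"
proof -
  have "\<not> (M x y \<and> M y z \<and> M x z)" "\<not> (N x y \<and> N y z \<and> N x z)"
    using M.no_triangle N.no_triangle by blast+
  then have "opposite x y z \<or> opposite y x z \<or> opposite z x y"
    using assms red_sym blue_sym unfolding edge_def opposite_def exclusive_def by metis
  then show ?thesis
    using mixedI[of x y z] mixedI[of y x z] mixedI[of z x y] assms by (auto simp: insert_commute)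
qed

lemma mixed_edge: "\<lbrakk>mixed T; x \<in> T; y \<in> T; x \<noteq> y\<rbrakk> \<Longrightarrow> edge x y"
  unfolding mixed_def using opposite_edge opposite_sym edge_sym by blast

definition lost :: "('a \<Rightarrow> 'a \<Rightarrow> 'a \<Rightarrow> bool) \<Rightarrow> ('a \<Rightarrow> 'a \<Rightarrow> 'a \<Rightarrow> bool) \<Rightarrow> 'a set \<Rightarrow> bool" where
  "lost q q' T \<longleftrightarrow> mixed T \<and> good q T \<and> \<not> good q' T"

definition improvable :: "('a \<Rightarrow> 'a \<Rightarrow> 'a \<Rightarrow> bool) \<Rightarrow> 'a set \<Rightarrow> bool" where
  "improvable q T \<longleftrightarrow> (\<exists>q'. transition_system q' \<and> good q' T \<and> (\<forall>T'. \<not> lost q q' T'))"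

lemma improvable_via:
  assumes "transition_system q'" "good q' T"
    and improvable: "\<And>T'. lost q q' T' \<Longrightarrow> improvable q' T'"
    and unique: "\<And>T\<^sub>1 T\<^sub>2. lost q q' T\<^sub>1 \<Longrightarrow> lost q q' T\<^sub>2 \<Longrightarrow> T\<^sub>1 = T\<^sub>2"
    and "mixed T"
  shows "improvable q T"
proof (cases "\<exists>T'. lost q q' T'")
  case False
  then show ?thesis using assms(1,2) unfolding improvable_def by blast
next
  case True
  then obtain T' where T': "lost q q' T'" by blast
  then obtain q'' where q'': "transition_system q''" "good q'' T'" "\<And>T. \<not> lost q' q'' T"
    using improvable unfolding improvable_def by blast
  have "\<not> lost q q'' T''" for T''
    using q''(2,3) T' unique[OF T', of T''] unfolding lost_def by blast
  then show ?thesis using q'' assms(2,5) unfolding improvable_def lost_def by blast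
qed

lemma transition_meets_unmatched:
  assumes q: "transition_system q" and ab: "opposite u a b" "\<not> q u a b" and cd: "q u c d"
  shows "a \<in> {c, d} \<or> b \<in> {c, d}"
proof -
  note q_u = transition_systemD[OF q, of u]
  have meets: "y = a" if "q u x y" "opposite u a x" "x \<noteq> b" for x y
  proof -
    have "q u a x" using transition_complement[OF q_u ab(1) that(2)] ab(2) that(3) by blast
    then show ?thesis using that(1) transition_sym[OF q_u] transition_unique[OF q_u] by blast
  qed
  have "q u d c" using transition_sym[OF q_u cd] .
  moreover have "opposite u a c \<or> opposite u a d"
    using opposite_either[OF ab(1) transition_opposite[OF q_u cd]] .
  ultimately show ?thesis using meets cd by blast
qed

lemma lost_by_flip:
  assumes q: "transition_system q" and ab: "opposite u a b" "\<not> q u a b"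
    and T: "lost q (flip u q) T"
  obtains c v where "c \<in> {a, b}" "T = {u, c, v}" "q u c v" "edge c v" "\<not> q c u v" "\<not> q v u c"
proof -
  obtain x y z where xyz: "T = {x, y, z}" "q x y z"
    using T unfolding lost_def good_def by blast
  have opp: "opposite x y z" using transition_opposite[OF transition_systemD[OF q] xyz(2)] .
  note dist = opposite_distinct[OF opp]
  have [simp]: "x = u" using T xyz flip_other goodI unfolding lost_def by metis
  have sym: "q u z y" using xyz(2) transition_sym[OF transition_systemD[OF q]] by simp
  have "edge y z" "edge z y" using T mixed_edge[of T] xyz(1) dist unfolding lost_def by auto
  moreover have "\<not> q c u v" if "T = {u, c, v}" "c \<noteq> u" for c v
    using that T goodI[of "flip u q" c u v] flip_other[of c u q]
    unfolding lost_def by (auto simp: insert_commute)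
  ultimately show ?thesis
    using that[of y z] that[of z y] transition_meets_unmatched[OF q ab, of y z] xyz sym dist
    by (auto simp: insert_commute)
qed

lemma opposite_at_common:
  assumes "opposite u a b" "M a b" "N a b" and "edge a v" "v \<noteq> u" "v \<noteq> b"
  shows "opposite a u v"
  using assms M.degree[of a u b v] N.degree[of a u b v] M.adj_sym N.adj_sym
  unfolding opposite_def exclusive_def edge_def by metis

lemma transition_forced_at_common:
  assumes q: "transition_system q" and ab: "opposite u a b" "M a b" "N a b"
    and v: "opposite a u v"
  shows "q a u v"
proof -
  have unique: "c = d" if "opposite a c e" "opposite a d e" for c d e
    using that ab M.degree[of a c d b] N.degree[of a c d b]
    unfolding opposite_def exclusive_def by blast
  show ?thesis
    using transition_forced[OF transition_systemD[OF q] v] unique v opposite_sym by blast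
qed

lemma improvable_common:
  assumes q: "transition_system q" and ab: "opposite u a b" "M a b" "N a b" and bad: "\<not> q u a b"
  shows "improvable q {u, a, b}"
proof -
  have ba: "opposite u b a" "M b a" "N b a"
    using ab opposite_sym M.adj_sym N.adj_sym by blast+
  have "\<not> lost q (flip u q) T" for T
  proof
    assume "lost q (flip u q) T"
    with q ab(1) bad show False
    proof (rule lost_by_flip)
      fix c v assume c: "c \<in> {a, b}" and v: "q u c v" "edge c v" "\<not> q c u v"
      then have "\<not> q u c (if c = a then b else a)"
        using bad transition_sym[OF transition_systemD[OF q]] by auto
      then have "v \<noteq> u" "v \<noteq> (if c = a then b else a)"
        using v(1) opposite_distinct transition_opposite[OF transition_systemD[OF q] v(1)] by auto
      then have "opposite c u v"
        using c v(2) opposite_at_common[OF ab, of v] opposite_at_common[OF ba, of v]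
        by (auto split: if_splits)
      then show False
        using c v(3) transition_forced_at_common[OF q ab, of v]
          transition_forced_at_common[OF q ba, of v] by blast
    qed
  qed
  moreover have "good (flip u q) {u, a, b}" using ab bad by (simp add: goodI flip_same)
  ultimately show ?thesis
    using transition_system_flip[OF q ab(1) bad] unfolding improvable_def by blast
qed

definition bad_triangle :: "('a \<Rightarrow> 'a \<Rightarrow> 'a \<Rightarrow> bool) \<Rightarrow> 'a \<Rightarrow> 'a \<Rightarrow> 'a \<Rightarrow> bool" where
  "bad_triangle q u w x \<longleftrightarrow> transition_system q \<and>
     opposite u w x \<and> opposite w u x \<and> \<not> q u w x \<and> \<not> q w u x"

lemma bad_triangle_commute: "bad_triangle q u w x \<longleftrightarrow> bad_triangle q w u x"
  unfolding bad_triangle_def by blast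

lemma bad_triangle_colours:
  assumes "bad_triangle q u w x"
  shows "red u w \<Longrightarrow> blue u x \<and> blue w x" and "blue u w \<Longrightarrow> red u x \<and> red w x"
  using assms red_sym blue_sym red_not_blue unfolding bad_triangle_def opposite_def by blast+

lemma bad_triangle_flip:
  assumes bad: "bad_triangle q u w x"
  shows "transition_system (flip u q)" and "good (flip u q) {u, w, x}" and "mixed {u, w, x}"
proof -
  have u: "opposite u w x" "\<not> q u w x" and w: "opposite w u x"
    using bad unfolding bad_triangle_def by auto
  show "transition_system (flip u q)"
    using bad transition_system_flip u unfolding bad_triangle_def by blast
  show "good (flip u q) {u, w, x}" using u by (simp add: goodI flip_same)
  have "edge w x" using w opposite_edge opposite_sym by blast
  with u(1) show "mixed {u, w, x}" by (rule mixedI)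
qed

lemma bad_triangle_after_flip:
  assumes "bad_triangle (flip u q) a u b"
  shows "red u b \<or> blue u a \<Longrightarrow> red u b \<and> red a b \<and> blue u a \<and> \<not> q a u b"
    and "blue u b \<or> red u a \<Longrightarrow> blue u b \<and> blue a b \<and> red u a \<and> \<not> q a u b"
proof -
  have au: "opposite a u b" and ua: "opposite u a b" and "\<not> flip u q a u b"
    using assms unfolding bad_triangle_def by auto
  moreover have "a \<noteq> u" using opposite_distinct[OF au] by auto
  ultimately have "\<not> q a u b" by (simp add: flip_other)
  then show "red u b \<or> blue u a \<Longrightarrow> red u b \<and> red a b \<and> blue u a \<and> \<not> q a u b"
    and "blue u b \<or> red u a \<Longrightarrow> blue u b \<and> blue a b \<and> red u a \<and> \<not> q a u b"
    using au ua red_sym blue_sym red_not_blue unfolding opposite_def by blast+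
qed

lemma opposite_beside_bad_triangle:
  assumes bad: "bad_triangle q u w x" and v: "opposite u w v" "edge w v" "v \<noteq> x" "\<not> q w u v"
  shows "opposite v u w"
proof -
  have q: "transition_system q" and w: "opposite w u x" "\<not> q w u x"
    using bad unfolding bad_triangle_def by auto
  from v(1,2) show ?thesis
  proof (cases rule: opposite_cases)
    case common
    then show ?thesis using transition_forced_at_common[OF q v(1)] w by blast
  next
    case first
    then have "q w u v"
      using transition_complement[OF transition_systemD[OF q] w(1)] w(2) v(3) by blast
    then show ?thesis using v(4) by blast
  qed
qed

lemma opposite_at_apex:
  assumes bad: "bad_triangle q u w x" and v: "opposite u x v" "edge x v" "v \<noteq> w"
  shows "opposite x u v"
proof -
  have w: "opposite w u x" and u: "opposite u w x"
    using bad unfolding bad_triangle_def by auto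
  then show ?thesis
    using v blue_saturated[of x u w v] red_saturated[of x u w v] red_sym blue_sym
      opposite_distinct[OF v(1)] opposite_distinct[OF w]
    unfolding opposite_def by (auto dest: red_not_blue)
qed

lemma lost_by_flip_bad_triangle:
  assumes bad: "bad_triangle q u w x" and T: "lost q (flip u q) T"
  obtains (side) v where "T = {v, u, w}" "bad_triangle (flip u q) v u w"
  | (apex) v where "T = {x, u, v}" "bad_triangle (flip u q) x u v"
proof -
  have q: "transition_system q" and u: "opposite u w x" "\<not> q u w x"
    using bad unfolding bad_triangle_def by auto
  note q_u = transition_systemD[OF q, of u]
  obtain c v where c: "c \<in> {w, x}" "T = {u, c, v}"
    and v: "q u c v" "edge c v" "\<not> q c u v" "\<not> q v u c"
    using q u T by (rule lost_by_flip)
  have cv: "opposite u c v" using transition_opposite[OF q_u v(1)] .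
  have "v \<noteq> w" "v \<noteq> x"
    using u(2) v(1) c(1) transition_sym[OF q_u] opposite_distinct[OF cv] by auto
  have unmatched: "\<not> flip u q c u v" "\<not> flip u q v u c" "\<not> flip u q u c v" "\<not> flip u q u v c"
    using v opposite_distinct[OF cv] transition_sym[OF q_u v(1)]
    by (auto simp: flip_same flip_other)
  from c(1) consider (w) "c = w" | (x) "c = x" by blast
  then show ?thesis
  proof cases
    case w
    then have "opposite v u w"
      using opposite_beside_bad_triangle[OF bad] cv v \<open>v \<noteq> x\<close> by blast
    then show ?thesis
      using side[of v] w c(2) unmatched bad_triangle_flip(1)[OF bad] cv opposite_sym
      unfolding bad_triangle_def by (auto simp: insert_commute)
  next
    case x
    then have "opposite x u v" using opposite_at_apex[OF bad] cv v \<open>v \<noteq> w\<close> by blast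
    then show ?thesis
      using apex[of v] x c(2) unmatched bad_triangle_flip(1)[OF bad] cv
      unfolding bad_triangle_def by (auto simp: insert_commute)
  qed
qed

lemma flip_matches_bad_triangle:
  assumes "bad_triangle q u w x"
  shows "flip u q u x w"
  using assms transition_sym[OF transition_systemD] opposite_sym
  unfolding bad_triangle_def flip_same by blast

lemma side_unique:
  assumes bad: "bad_triangle q u w x"
    and v: "bad_triangle (flip u q) v u w" "bad_triangle (flip u q) v' u w"
  shows "v = v'"
proof -
  have "v \<noteq> x" "v' \<noteq> x"
    using v flip_matches_bad_triangle[OF bad] unfolding bad_triangle_def by blast+
  then show ?thesis
    using opposite_degree[of u w x v v'] bad v opposite_sym unfolding bad_triangle_def by blast
qed

lemma apex_unique:
  assumes bad: "bad_triangle q u w x"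
    and v: "bad_triangle (flip u q) x u v" "bad_triangle (flip u q) x u v'"
  shows "v = v'"
proof -
  have "v \<noteq> w" "v' \<noteq> w"
    using v flip_matches_bad_triangle[OF bad] unfolding bad_triangle_def by blast+
  then show ?thesis
    using opposite_degree[of u x w v v'] bad v opposite_sym unfolding bad_triangle_def by blast
qed

lemma improvable_if_no_apex:
  assumes bad: "bad_triangle q u w x" and no_apex: "\<And>v. \<not> bad_triangle (flip u q) x u v"
    and side: "\<And>v. bad_triangle (flip u q) v u w \<Longrightarrow> improvable (flip u q) {v, u, w}"
  shows "improvable q {u, w, x}"
proof (rule improvable_via)
  show "improvable (flip u q) T" if "lost q (flip u q) T" for T
    using bad that by (rule lost_by_flip_bad_triangle) (use side no_apex in auto)
  show "T\<^sub>1 = T\<^sub>2" if "lost q (flip u q) T\<^sub>1" "lost q (flip u q) T\<^sub>2" for T\<^sub>1 T\<^sub>2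
    using lost_by_flip_bad_triangle[OF bad] that no_apex side_unique[OF bad] by metis
qed (rule bad_triangle_flip[OF bad])+

lemma improvable_if_no_side:
  assumes bad: "bad_triangle q u w x" and no_side: "\<And>v. \<not> bad_triangle (flip u q) v u w"
    and apex: "\<And>v. bad_triangle (flip u q) x u v \<Longrightarrow> improvable (flip u q) {x, u, v}"
  shows "improvable q {u, w, x}"
proof (rule improvable_via)
  show "improvable (flip u q) T" if "lost q (flip u q) T" for T
    using bad that by (rule lost_by_flip_bad_triangle) (use apex no_side in auto)
  show "T\<^sub>1 = T\<^sub>2" if "lost q (flip u q) T\<^sub>1" "lost q (flip u q) T\<^sub>2" for T\<^sub>1 T\<^sub>2
    using lost_by_flip_bad_triangle[OF bad] that no_side apex_unique[OF bad] by metis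
qed (rule bad_triangle_flip[OF bad])+

end

section \<open>Clusters\<close>

definition cluster ::
    "('a \<Rightarrow> 'a \<Rightarrow> bool) \<Rightarrow> ('a \<Rightarrow> 'a \<Rightarrow> bool) \<Rightarrow> 'a \<Rightarrow> 'a \<Rightarrow> 'a \<Rightarrow> 'a \<Rightarrow> 'a \<Rightarrow> bool" where
  "cluster R B a b c d e \<longleftrightarrow>
     R a b \<and> R b c \<and> R c d \<and> R d e \<and> B a c \<and> B c e \<and> B e b \<and> B b d \<and> B d a"

context matching_pair
begin

definition is_cluster :: "'a set \<Rightarrow> bool" where
  "is_cluster K \<longleftrightarrow> (\<exists>a b c d e. K = {a, b, c, d, e} \<and>
     (cluster red blue a b c d e \<or> cluster blue red a b c d e))"

definition in_cluster :: "'a set \<Rightarrow> bool" where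
  "in_cluster T \<longleftrightarrow> (\<exists>K. is_cluster K \<and> T \<subseteq> K)"

lemma in_clusterI: "\<lbrakk>cluster red blue a b c d e \<or> cluster blue red a b c d e; T \<subseteq> {a, b, c, d, e}\<rbrakk>
    \<Longrightarrow> in_cluster T"
  unfolding in_cluster_def is_cluster_def by blast

end

section \<open>Bad triangles are improvable or in clusters\<close>

locale red_bad_triangle = matching_pair M N for M N :: "'a \<Rightarrow> 'a \<Rightarrow> bool" +
  fixes q :: "'a \<Rightarrow> 'a \<Rightarrow> 'a \<Rightarrow> bool" and u w x :: 'a
  assumes bad: "bad_triangle q u w x" and red_uw: "red u w"
begin

lemma swap_corners: "red_bad_triangle M N q w u x"
  using bad red_uw bad_triangle_commute red_sym by unfold_locales auto

lemma red_wu: "red w u"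
  and blue_ux: "blue u x" and blue_xu: "blue x u"
  and blue_wx: "blue w x" and blue_xw: "blue x w"
  using red_uw red_sym bad_triangle_colours(1)[OF bad red_uw] blue_sym by blast+

lemma distinct_triangle: "distinct [u, w, x]"
  using red_uw blue_ux blue_wx red_neq blue_neq by auto

lemma blue_x: "blue x y \<Longrightarrow> y = u \<or> y = w"
  using blue_degree[OF blue_xu blue_xw] distinct_triangle by simp

lemma transitions: "transitions_at v (q v)"
  using bad unfolding bad_triangle_def by (blast intro: transition_systemD)

lemma transition_u: "blue u v \<Longrightarrow> v \<noteq> x \<Longrightarrow> q u w v"
  using transition_complement[OF transitions, of u w v x] bad red_uw blue_ux
  unfolding bad_triangle_def opposite_def by blast

lemma transition_x: "red x v \<Longrightarrow> q x u v \<longleftrightarrow> \<not> q x w v"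
  using transition_complement[OF transitions, of x v u w] transition_sym[OF transitions]
    blue_xu blue_xw distinct_triangle unfolding opposite_def by auto

text \<open>
  The two ways in which flipping \<open>u\<close> creates a new bad triangle, on the side \<open>u w\<close> or at the
  apex \<open>x\<close>.
\<close>

definition side_obstruction :: "'a \<Rightarrow> bool" where
  "side_obstruction v \<longleftrightarrow> red w v \<and> blue u v \<and> \<not> q v u w"

definition apex_obstruction :: "'a \<Rightarrow> bool" where
  "apex_obstruction v \<longleftrightarrow> red u v \<and> red x v \<and> \<not> q x u v"

lemma bad_triangle_at_side: "bad_triangle (flip u q) v u w \<Longrightarrow> side_obstruction v"
  unfolding side_obstruction_def
  using bad_triangle_after_flip(1)[of u q v w] red_uw red_sym by blast

lemma bad_triangle_at_apex: "bad_triangle (flip u q) x u v \<Longrightarrow> apex_obstruction v"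
  unfolding apex_obstruction_def
  using bad_triangle_after_flip(1)[of u q x v] blue_ux by blast

lemma improvable_if_unobstructed:
  assumes "\<And>v. \<not> side_obstruction v" "\<And>v. \<not> apex_obstruction v"
  shows "improvable q {u, w, x}"
  using improvable_if_no_apex[OF bad] assms bad_triangle_at_side bad_triangle_at_apex by blast

lemma improvable_via_side:
  assumes no_apex: "\<And>v. \<not> apex_obstruction v"
    and side: "\<And>v. red w v \<Longrightarrow> blue u v \<Longrightarrow> red x v \<Longrightarrow> q x u v"
    and step: "\<And>v z. bad_triangle (flip v (flip u q)) w v z \<Longrightarrow> red w v \<Longrightarrow> blue u v \<Longrightarrow>
      improvable (flip v (flip u q)) {w, v, z}"
  shows "improvable q {u, w, x}"
proof (rule improvable_if_no_apex[OF bad])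
  show "\<not> bad_triangle (flip u q) x u v" for v
    using no_apex bad_triangle_at_apex by blast
  fix v assume bad_v: "bad_triangle (flip u q) v u w"
  then have v: "red w v" "blue u v"
    using bad_triangle_at_side unfolding side_obstruction_def by blast+
  have "\<not> bad_triangle (flip v (flip u q)) z v u" for z
  proof
    assume "bad_triangle (flip v (flip u q)) z v u"
    then have z: "blue z u" "red v z" "\<not> flip u q z v u"
      using bad_triangle_after_flip(2)[of v "flip u q" z u] v(2) blue_sym by blast+
    then have "z = x"
      using blue_degree[OF blue_ux v(2), of z] blue_sym v(1) blue_wx red_not_blue red_neq by blast
    then show False
      using z side[of v] v red_sym transition_sym[OF transitions] distinct_triangle
      by (auto simp: flip_other)
  qed
  then show "improvable (flip u q) {v, u, w}"
    using improvable_if_no_side[OF bad_v] step v by blast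
qed

lemma improvable_via_apex:
  assumes no_side: "\<And>v. \<not> side_obstruction v"
    and apex: "\<And>v. red x v \<Longrightarrow> \<not> blue u v"
    and step: "\<And>v. bad_triangle (flip x (flip u q)) v x w \<Longrightarrow> red u v \<Longrightarrow> red x v \<Longrightarrow>
      improvable (flip x (flip u q)) {v, x, w}"
  shows "improvable q {u, w, x}"
proof (rule improvable_if_no_side[OF bad])
  show "\<not> bad_triangle (flip u q) v u w" for v
    using no_side bad_triangle_at_side by blast
  fix v assume bad_v: "bad_triangle (flip u q) x u v"
  then have v: "red u v" "red x v"
    using bad_triangle_at_apex unfolding apex_obstruction_def by blast+
  have no_new_side: "\<not> bad_triangle (flip x (flip u q)) z x u" for z
    using bad_triangle_after_flip(2)[of x "flip u q" z u] blue_xu apex blue_sym by blast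
  have "improvable (flip x (flip u q)) {v, x, z}"
    if z: "bad_triangle (flip x (flip u q)) v x z" for z
  proof -
    have "blue x z" "blue v z" using bad_triangle_after_flip(2)[OF z] v(2) by blast+
    then have "z = w" using blue_x v(1) red_not_blue blue_sym by blast
    then show ?thesis using step z v by simp
  qed
  then show "improvable (flip u q) {x, u, v}"
    using improvable_if_no_side[OF bad_v no_new_side] by blast
qed

context
  fixes u' w'
  assumes u': "red u u'" "red x u'" and w': "red w w'" "red x w'"
begin

lemma red_neighbours:
  shows "red u v \<Longrightarrow> v = w \<or> v = u'" and "red w v \<Longrightarrow> v = u \<or> v = w'"
    and "red x v \<Longrightarrow> v = u' \<or> v = w'"
proof -
  have neq: "u' \<noteq> w" "w' \<noteq> u" using u'(2) w'(2) blue_xw blue_xu red_not_blue by blast+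
  show "red u v \<Longrightarrow> v = w \<or> v = u'" using red_degree[OF red_uw u'(1)] neq by blast
  show "red w v \<Longrightarrow> v = u \<or> v = w'" using red_degree[OF red_wu w'(1)] neq by blast
  have "u' \<noteq> w'"
    using u'(1) w'(1) red_uw M.no_triangle[of u w w'] unfolding exclusive_def by blast
  then show "red x v \<Longrightarrow> v = u' \<or> v = w'" using red_degree[OF u'(2) w'(2)] by blast
qed

lemma apex_neighbours_two_flips:
  assumes no_side: "\<not> blue w u'" "\<not> blue u w'"
  shows "improvable q {u, w, x}"
proof (rule improvable_via_apex)
  fix v
  show "\<not> side_obstruction v"
    using red_neighbours(2) no_side(2) blue_neq unfolding side_obstruction_def by blast
  show "\<not> blue u v" if "red x v"
    using red_neighbours(3)[OF that] no_side(2) u'(1) red_not_blue by blast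
  assume bad_v: "bad_triangle (flip x (flip u q)) v x w" and "red u v" "red x v"
  then have "blue w v" using bad_triangle_after_flip(2)[OF bad_v] blue_sym by blast
  then show "improvable (flip x (flip u q)) {v, x, w}"
    using no_side(1) red_neighbours(1)[OF \<open>red u v\<close>] blue_neq by blast
qed

lemma apex_neighbours_three_flips:
  assumes side: "blue u w'" and no_side: "\<not> blue w u'" and no_link: "\<not> blue w' u'"
  shows "improvable q {w, u, x}"
proof -
  interpret mirror: red_bad_triangle M N q w u x by (rule swap_corners)
  let ?q = "flip x (flip w q)"
  have q_u: "?q u = q u" using distinct_triangle by (simp add: flip_other)
  have last_flip: "improvable ?q {w', x, u}" if bad_w': "bad_triangle ?q w' x u"
  proof (rule improvable_if_no_apex[OF bad_w'])
    fix z
    show "\<not> bad_triangle (flip w' ?q) u w' z"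
    proof
      assume "bad_triangle (flip w' ?q) u w' z"
      then have z: "red w' z" "red u z" "\<not> q u w' z"
        using bad_triangle_after_flip(1)[of w' ?q u z] side blue_sym q_u by auto
      then have "z = w"
        using red_degree[of w' w x z] w' red_sym distinct_triangle blue_ux red_not_blue by auto
      then show False
        using z(3) transition_u[OF side] transition_sym[OF transitions] w'(2) red_neq by blast
    qed
    have "\<not> bad_triangle (flip w' ?q) z w' x"
      using bad_triangle_after_flip(1)[of w' ?q z x] w'(2) red_sym red_neighbours(3) no_link
        blue_neq by blast
    then show "improvable (flip w' ?q) {z, w', x}" if "bad_triangle (flip w' ?q) z w' x"
      using that by blast
  qed
  show ?thesis
  proof (rule mirror.improvable_via_apex)
    fix v
    show "\<not> mirror.side_obstruction v"
      using red_neighbours(1) no_side blue_neq unfolding mirror.side_obstruction_def by blast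
    show "\<not> blue w v" if "red x v"
      using red_neighbours(3)[OF that] no_side w'(1) red_not_blue by blast
    assume "bad_triangle ?q v x u" "red w v" "red x v"
    moreover have "v = w'" using \<open>red w v\<close> \<open>red x v\<close> red_neighbours(2) blue_xu red_not_blue by blast
    ultimately show "improvable ?q {v, x, u}" using last_flip by blast
  qed
qed

lemma apex_neighbours_no_side:
  assumes no_side: "\<not> blue w u'"
  shows "improvable q {u, w, x} \<or> in_cluster {u, w, x}"
proof -
  consider (no_sides) "\<not> blue u w'" | (cluster) "blue u w'" "blue w' u'"
    | (one_side) "blue u w'" "\<not> blue w' u'"
    by blast
  then show ?thesis
  proof cases
    case no_sides
    then show ?thesis using apex_neighbours_two_flips[OF no_side] by blast
  next
    case cluster
    then have "cluster blue red u' w' u x w"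
      unfolding cluster_def using u' w' red_uw blue_ux blue_xw red_sym blue_sym by blast
    then show ?thesis using in_clusterI[of u' w' u x w "{u, w, x}"] by simp
  next
    case one_side
    then show ?thesis using apex_neighbours_three_flips no_side by (simp add: insert_commute)
  qed
qed

end

lemma apex_neighbours:
  assumes u': "red u u'" "red x u'" and w': "red w w'" "red x w'"
  shows "improvable q {u, w, x} \<or> in_cluster {u, w, x}"
proof -
  interpret mirror: red_bad_triangle M N q w u x by (rule swap_corners)
  consider (no_side_w) "\<not> blue w u'" | (no_side_u) "\<not> blue u w'"
    | (cluster) "blue w u'" "blue u w'"
    by blast
  then show ?thesis
  proof cases
    case no_side_w
    then show ?thesis using apex_neighbours_no_side[OF u' w'] by blast
  next
    case no_side_u
    then show ?thesis using mirror.apex_neighbours_no_side[OF w' u'] by (simp add: insert_commute)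
  next
    case cluster
    then have "cluster blue red u' w x u w'"
      unfolding cluster_def using u' w' red_wu blue_wx blue_xu red_sym blue_sym by blast
    then show ?thesis using in_clusterI[of u' w x u w' "{u, w, x}"] by simp
  qed
qed

context
  fixes u' w'
  assumes u': "red u u'" "blue w u'" and w': "red w w'" "blue u w'"
begin

lemma side_neighbours_neq: "u' \<noteq> u" "u' \<noteq> w" "u' \<noteq> x" "w' \<noteq> u" "w' \<noteq> w" "w' \<noteq> x"
  using u' w' blue_ux blue_wx red_not_blue blue_neq red_neq by blast+

lemma side_neighbours_no_apex: "(red x u' \<Longrightarrow> q x u u') \<Longrightarrow> \<not> apex_obstruction v"
  using red_degree[OF red_uw u'(1), of v] side_neighbours_neq blue_xw red_not_blue
  unfolding apex_obstruction_def by blast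

lemma side_neighbour_unique: "red w v \<Longrightarrow> blue u v \<Longrightarrow> v = w'"
  using red_degree[OF red_wu w'(1)] side_neighbours_neq blue_neq by blast

lemma blue_neighbours:
  shows "blue u v \<Longrightarrow> v = x \<or> v = w'" and "blue w v \<Longrightarrow> v = x \<or> v = u'"
  using blue_degree[OF blue_ux w'(2)] blue_degree[OF blue_wx u'(2)] side_neighbours_neq by blast+

lemma side_neighbours_two_flips:
  assumes no_link: "\<not> blue w' u'"
    and apex: "red x u' \<Longrightarrow> q x u u'" "red x w' \<Longrightarrow> q x u w'"
  shows "improvable q {u, w, x}"
proof (rule improvable_via_side)
  fix v
  show "\<not> apex_obstruction v" using side_neighbours_no_apex apex(1) .
  show "q x u v" if "red w v" "blue u v" "red x v"
    using that side_neighbour_unique apex(2) by blast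
  fix z assume bad_z: "bad_triangle (flip v (flip u q)) w v z" and v: "red w v" "blue u v"
  then have "blue v z" "blue w z" using bad_triangle_after_flip(2)[OF bad_z] red_sym by blast+
  moreover have "v = w'" using side_neighbour_unique v by blast
  moreover have "z \<noteq> x" using \<open>blue v z\<close> \<open>v = w'\<close> blue_x side_neighbours_neq blue_sym by blast
  ultimately have False using blue_neighbours(2) no_link by blast
  then show "improvable (flip v (flip u q)) {w, v, z}" ..
qed

lemma side_neighbours_last_flips:
  assumes link: "blue w' u'" and no_apex: "\<not> red x u'" "\<not> red x w'"
    and bad: "bad_triangle p w w' u'" and u_flipped: "p u u' w'"
  shows "improvable p {w, w', u'}"
proof (rule improvable_if_no_side[OF bad])
  fix y
  show "\<not> bad_triangle (flip w p) y w w'"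
    using bad_triangle_after_flip(1)[of w p y w'] w'(1) blue_neighbours(2) no_apex(2) link
      red_not_blue blue_sym red_sym by blast
  assume bad_y: "bad_triangle (flip w p) u' w y"
  then have "red w y" "red u' y" using bad_triangle_after_flip(1)[OF bad_y] u'(2) by simp_all
  then have [simp]: "y = u"
    using red_degree[OF red_wu w'(1), of y] side_neighbours_neq link red_not_blue blue_sym by blast
  have "\<not> bad_triangle (flip u' (flip w p)) z u' w" for z
    using bad_triangle_after_flip(2)[of u' "flip w p" z w] u'(2) no_apex(1) blue_neighbours(2)
      blue_sym red_sym red_neq by blast
  moreover have "\<not> bad_triangle (flip u' (flip w p)) u u' z" for z
  proof
    assume bad_z: "bad_triangle (flip u' (flip w p)) u u' z"
    then have z: "blue u z" "blue u' z" "\<not> p u u' z"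
      using bad_triangle_after_flip(2)[OF bad_z] u'(1) red_sym distinct_triangle
      by (auto simp: flip_other)
    then show False
      using blue_neighbours(1) blue_x[of u'] u_flipped side_neighbours_neq blue_sym by blast
  qed
  ultimately show "improvable (flip w p) {u', w, y}"
    using improvable_if_no_side[of "flip w p" u' w u] bad_y by simp
qed

text \<open>The bad triangle moves to \<open>{u, w, w'}\<close>, \<open>{w, w', u'}\<close> and \<open>{u', w, u}\<close>, and vanishes.\<close>

lemma side_neighbours_four_flips:
  assumes link: "blue w' u'" and no_apex: "\<not> red x u'" "\<not> red x w'"
  shows "improvable q {u, w, x}"
proof (rule improvable_via_side)
  fix v
  show "\<not> apex_obstruction v" using side_neighbours_no_apex no_apex(1) by blast
  show "q x u v" if "red w v" "blue u v" "red x v"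
    using that side_neighbour_unique no_apex(2) by blast
  fix z assume bad_z: "bad_triangle (flip v (flip u q)) w v z" and v: "red w v" "blue u v"
  have [simp]: "v = w'" using side_neighbour_unique v by blast
  have "blue w z" "blue w' z" using bad_triangle_after_flip(2)[OF bad_z] red_sym w'(1) by simp_all
  then have [simp]: "z = u'" using blue_neighbours(2) blue_x side_neighbours_neq blue_sym by blast
  have "\<not> q u u' w'"
    using transition_u[OF w'(2)] transition_unique[OF transitions, of u w' w u']
      transition_sym[OF transitions] side_neighbours_neq by blast
  then have "flip v (flip u q) u u' w'"
    using u'(1) w'(2) side_neighbours_neq by (simp add: flip_other flip_same opposite_def)
  then show "improvable (flip v (flip u q)) {w, v, z}"
    using side_neighbours_last_flips[OF link no_apex] bad_z by simp
qed

end

lemma side_neighbours: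
  assumes u': "red u u'" "blue w u'" and w': "red w w'" "blue u w'"
  shows "improvable q {u, w, x} \<or> in_cluster {u, w, x}"
proof -
  interpret mirror: red_bad_triangle M N q w u x by (rule swap_corners)
  note syms = red_sym blue_sym red_uw red_wu blue_ux blue_xu blue_wx blue_xw u' w'
  consider (both_red) "red x u'" "red x w'"
    | (link_red_u') "blue w' u'" "red x u'" | (link_red_w') "blue w' u'" "red x w'"
    | (four_flips) "blue w' u'" "\<not> red x u'" "\<not> red x w'"
    | (two_flips_u) "\<not> blue w' u'" "red x u' \<longrightarrow> q x u u'" "red x w' \<longrightarrow> q x u w'"
    | (two_flips_w) "\<not> blue w' u'" "red x u' \<longrightarrow> q x w u'" "red x w' \<longrightarrow> q x w w'"
    using transition_x by blast
  then show ?thesis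
  proof cases
    case both_red
    then have "cluster blue red w' u x w u'" unfolding cluster_def using syms by blast
    then show ?thesis using in_clusterI[of w' u x w u' "{u, w, x}"] by simp
  next
    case link_red_u'
    then have "cluster red blue x u' u w w'" unfolding cluster_def using syms by blast
    then show ?thesis using in_clusterI[of x u' u w w' "{u, w, x}"] by simp
  next
    case link_red_w'
    then have "cluster red blue x w' w u u'" unfolding cluster_def using syms by blast
    then show ?thesis using in_clusterI[of x w' w u u' "{u, w, x}"] by simp
  next
    case four_flips
    then show ?thesis using side_neighbours_four_flips[OF u' w'] by blast
  next
    case two_flips_u
    then show ?thesis using side_neighbours_two_flips[OF u' w'] by blast
  next
    case two_flips_w
    then have "improvable q {w, u, x}"
      using mirror.side_neighbours_two_flips[OF w' u'] blue_sym by blast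
    then show ?thesis by (simp add: insert_commute)
  qed
qed

context
  fixes w'
  assumes w': "red w w'" "red x w'" "blue u w'" "\<not> q w' u w" "\<not> q x w w'"
begin

lemma side_apex_neighbour_unique: "red w v \<Longrightarrow> blue u v \<or> red x v \<Longrightarrow> v = w'"
  using red_degree[OF red_wu w'(1)] w'(3) blue_xu blue_neq red_not_blue by blast

lemma side_apex_neighbour_flip_side:
  assumes no_apex: "\<And>v. \<not> apex_obstruction v" and no_common: "\<And>z. blue w z \<Longrightarrow> \<not> blue w' z"
  shows "improvable q {u, w, x}"
proof (rule improvable_via_side[OF no_apex])
  fix v
  show "q x u v" if "red w v" "blue u v" "red x v"
    using that side_apex_neighbour_unique w'(2,5) transition_x by blast
  fix z assume "bad_triangle (flip v (flip u q)) w v z" "red w v" "blue u v"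
  then have False
    using bad_triangle_after_flip(2)[of v "flip u q" w z] no_common side_apex_neighbour_unique
      red_sym by blast
  then show "improvable (flip v (flip u q)) {w, v, z}" ..
qed

lemma side_apex_neighbour_flip_apex:
  assumes z: "blue w z" "blue w' z" "\<not> red u z" "\<not> red x z"
  shows "improvable q {w, u, x}"
proof -
  interpret mirror: red_bad_triangle M N q w u x by (rule swap_corners)
  have neq: "w' \<noteq> u" "w' \<noteq> x" "w' \<noteq> w" using w' red_neq blue_neq by blast+
  then have "z \<noteq> x" using z(2) blue_x blue_sym by blast
  then have blue_w: "v = x \<or> v = z" if "blue w v" for v
    using blue_degree[OF blue_wx z(1) _ that] by blast
  show ?thesis
  proof (rule mirror.improvable_via_apex)
    fix v
    show "\<not> mirror.side_obstruction v"
      using blue_w z(3) blue_ux red_not_blue unfolding mirror.side_obstruction_def by blast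
    show "\<not> blue w v" if "red x v"
      using that blue_w z(4) red_neq by blast
    assume v: "bad_triangle (flip x (flip w q)) v x u" "red w v" "red x v"
    have "v = w'" using v(2,3) side_apex_neighbour_unique by blast
    moreover have "q w' x u"
      using transition_complement[OF transitions, of w' u w x] w' red_sym blue_sym
        transition_sym[OF transitions] distinct_triangle unfolding opposite_def by auto
    ultimately have False
      using bad_triangle_after_flip(2)[OF v(1)] blue_xu neq by (simp add: flip_other)
    then show "improvable (flip x (flip w q)) {v, x, u}" ..
  qed
qed

lemma side_apex_neighbour:
  assumes no_apex: "\<And>v. \<not> apex_obstruction v"
  shows "improvable q {u, w, x} \<or> in_cluster {u, w, x}"
proof -
  consider (red_u) z where "blue w z" "blue w' z" "red u z"
    | (red_x) z where "blue w z" "blue w' z" "red x z"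
    | (no_red) z where "blue w z" "blue w' z" "\<not> red u z" "\<not> red x z"
    | (no_common) "\<And>z. blue w z \<Longrightarrow> \<not> blue w' z" by blast
  then show ?thesis
  proof cases
    case (red_u z)
    then have "cluster red blue z u w w' x"
      unfolding cluster_def using w' red_uw blue_ux blue_wx red_sym blue_sym by blast
    then show ?thesis using in_clusterI[of z u w w' x "{u, w, x}"] by simp
  next
    case (red_x z)
    then have "cluster red blue u w w' x z"
      unfolding cluster_def using w' red_uw blue_xu blue_wx red_sym blue_sym by blast
    then show ?thesis using in_clusterI[of u w w' x z "{u, w, x}"] by simp
  next
    case (no_red z)
    then show ?thesis using side_apex_neighbour_flip_apex by (simp add: insert_commute)
  next
    case no_common
    then show ?thesis using side_apex_neighbour_flip_side no_apex by blast
  qed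
qed

end

lemma side_apex_obstructions:
  assumes "side_obstruction v" "red_bad_triangle.apex_obstruction M N q w x v'"
    and no_apex: "\<And>v. \<not> apex_obstruction v"
  shows "improvable q {u, w, x} \<or> in_cluster {u, w, x}"
proof -
  interpret mirror: red_bad_triangle M N q w u x by (rule swap_corners)
  have v: "red w v" "blue u v" "\<not> q v u w" and v': "red w v'" "red x v'" "\<not> q x w v'"
    using assms(1,2) unfolding side_obstruction_def mirror.apex_obstruction_def by blast+
  have "v \<noteq> u" "v' \<noteq> u" using v(2) v'(2) blue_xu blue_neq red_not_blue by blast+
  then have "v' = v" using red_degree[OF red_wu v(1) _ v'(1)] by blast
  then show ?thesis
    using side_apex_neighbour[of v] v v' no_apex by blast
qed

lemma improvable_or_in_cluster: "improvable q {u, w, x} \<or> in_cluster {u, w, x}"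
proof -
  interpret mirror: red_bad_triangle M N q w u x by (rule swap_corners)
  consider (unobstructed) "\<nexists>v. side_obstruction v" "\<nexists>v. apex_obstruction v"
    | (mirror_unobstructed) "\<nexists>v. mirror.side_obstruction v" "\<nexists>v. mirror.apex_obstruction v"
    | (apex_apex) v v' where "apex_obstruction v" "mirror.apex_obstruction v'"
    | (side_side) v v' where "side_obstruction v" "mirror.side_obstruction v'"
    | (side_apex) v v' where "side_obstruction v" "mirror.apex_obstruction v'"
        "\<nexists>v. apex_obstruction v"
    | (apex_side) v v' where "mirror.side_obstruction v" "apex_obstruction v'"
        "\<nexists>v. mirror.apex_obstruction v"
    by blast
  then show ?thesis
  proof cases
    case unobstructed
    then show ?thesis using improvable_if_unobstructed by blast
  next
    case mirror_unobstructed
    then show ?thesis using mirror.improvable_if_unobstructed by (simp add: insert_commute)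
  next
    case apex_apex
    then show ?thesis
      unfolding apex_obstruction_def mirror.apex_obstruction_def using apex_neighbours by blast
  next
    case side_side
    then show ?thesis
      unfolding side_obstruction_def mirror.side_obstruction_def using side_neighbours by blast
  next
    case side_apex
    then show ?thesis using side_apex_obstructions by blast
  next
    case apex_side
    then show ?thesis using mirror.side_apex_obstructions by (simp add: insert_commute)
  qed
qed

end

section \<open>Maximizing the number of good triangles\<close>

context matching_pair
begin

lemma swapped_edge: "matching_pair.edge N M = edge"
  unfolding matching_pair.edge_def[OF matching_pair_commute] edge_def by (intro ext) blast

lemma swapped_opposite: "matching_pair.opposite N M = opposite"
  unfolding matching_pair.opposite_def[OF matching_pair_commute] opposite_def by (intro ext) blast

lemma swapped_coloured: "matching_pair.coloured N M = coloured"
  unfolding matching_pair.coloured_def[OF matching_pair_commute] coloured_def by (intro ext) blast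

lemma swapped_transitions_at: "matching_pair.transitions_at N M = transitions_at"
  unfolding matching_pair.transitions_at_def[OF matching_pair_commute] transitions_at_def
    swapped_opposite ..

lemma swapped_transition_system: "matching_pair.transition_system N M = transition_system"
  unfolding matching_pair.transition_system_def[OF matching_pair_commute] transition_system_def
    swapped_transitions_at ..

lemma swapped_mixed: "matching_pair.mixed N M = mixed"
  unfolding matching_pair.mixed_def[OF matching_pair_commute] mixed_def
    swapped_opposite swapped_edge ..

lemma swapped_improvable: "matching_pair.improvable N M = improvable"
  unfolding matching_pair.improvable_def[OF matching_pair_commute] improvable_def
    matching_pair.lost_def[OF matching_pair_commute] lost_def
    swapped_transition_system swapped_mixed ..

lemma swapped_bad_triangle: "matching_pair.bad_triangle N M = bad_triangle"
  unfolding matching_pair.bad_triangle_def[OF matching_pair_commute] bad_triangle_def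
    swapped_transition_system swapped_opposite ..

lemma swapped_is_cluster: "matching_pair.is_cluster N M = is_cluster"
  unfolding matching_pair.is_cluster_def[OF matching_pair_commute] is_cluster_def
  by (intro ext) blast

lemma swapped_in_cluster: "matching_pair.in_cluster N M = in_cluster"
  unfolding matching_pair.in_cluster_def[OF matching_pair_commute] in_cluster_def
    swapped_is_cluster ..

lemmas swapped = swapped_edge swapped_opposite swapped_coloured swapped_transitions_at
  swapped_transition_system swapped_mixed swapped_improvable swapped_bad_triangle
  swapped_is_cluster swapped_in_cluster

lemma bad_triangle_improvable_or_in_cluster:
  assumes bad: "bad_triangle q u w x"
  shows "improvable q {u, w, x} \<or> in_cluster {u, w, x}"
proof -
  consider (red) "red u w" | (blue) "blue u w"
    using bad unfolding bad_triangle_def opposite_def by blast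
  then show ?thesis
  proof cases
    case red
    then have "red_bad_triangle M N q u w x" using bad by unfold_locales
    then show ?thesis by (rule red_bad_triangle.improvable_or_in_cluster)
  next
    case blue
    then have "red_bad_triangle N M q u w x"
      using bad matching_pair_commute swapped_bad_triangle
      by (simp add: red_bad_triangle_def red_bad_triangle_axioms_def)
    then show ?thesis using red_bad_triangle.improvable_or_in_cluster[of N M] by (simp add: swapped)
  qed
qed

lemma mixed_good_or_improvable_or_in_cluster:
  assumes q: "transition_system q" and T: "mixed T"
  shows "good q T \<or> improvable q T \<or> in_cluster T"
proof (cases "good q T")
  case False
  obtain u a b where uab: "T = {u, a, b}" "opposite u a b" "edge a b"
    using T unfolding mixed_def by blast
  have bad: "\<not> q y z v" if "{y, z, v} = T" for y z v
    using False that goodI[of q y z v] by auto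
  from uab(2,3) show ?thesis
  proof (cases rule: opposite_cases)
    case common
    then show ?thesis using improvable_common[OF q uab(2)] bad[of u a b] uab(1) by blast
  next
    case first
    then have "bad_triangle q u a b"
      using q uab bad[of u a b] bad[of a u b]
      unfolding bad_triangle_def by (simp add: insert_commute)
    then show ?thesis using bad_triangle_improvable_or_in_cluster uab(1) by blast
  next
    case second
    then have "bad_triangle q u b a"
      using q uab bad[of u b a] bad[of b u a] opposite_sym
      unfolding bad_triangle_def by (simp add: insert_commute)
    then show ?thesis
      using bad_triangle_improvable_or_in_cluster[of q u b a] uab(1) by (simp add: insert_commute)
  qed
qed simp

lemma finite_mixed:
  assumes "finite (coloured UNIV)"
  shows "finite (Collect mixed)"
proof (rule finite_surj)
  show "finite (coloured UNIV \<times> coloured UNIV)" using assms by blast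
  show "Collect mixed \<subseteq> (\<lambda>(e, f). e \<union> f) ` (coloured UNIV \<times> coloured UNIV)"
  proof
    fix T assume "T \<in> Collect mixed"
    then obtain u a b where uab: "T = {u, a, b}" "opposite u a b" unfolding mixed_def by blast
    then have "{u, a} \<in> coloured UNIV" "{u, b} \<in> coloured UNIV"
      unfolding coloured_def opposite_def by blast+
    moreover have "T = {u, a} \<union> {u, b}" using uab(1) by blast
    ultimately show "T \<in> (\<lambda>(e, f). e \<union> f) ` (coloured UNIV \<times> coloured UNIV)"
      by (auto intro: rev_image_eqI)
  qed
qed

lemma transition_system_good_outside_clusters:
  assumes fin: "finite (coloured UNIV)"
  shows "\<exists>q. transition_system q \<and> (\<forall>T. mixed T \<longrightarrow> good q T \<or> in_cluster T)"
proof -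
  let ?good = "\<lambda>q. {T. mixed T \<and> good q T}"
  have finite_good: "finite (?good q)" for q
    by (rule finite_subset[OF _ finite_mixed[OF fin]]) blast
  have bound: "card (?good q) < Suc (card (Collect mixed))" for q
    using card_mono[OF finite_mixed[OF fin], of "?good q"] by (auto simp: less_Suc_eq_le)
  obtain q\<^sub>0 where "transition_system q\<^sub>0" using transition_system_exists by blast
  from ex_has_greatest_nat[of transition_system, OF this, of "\<lambda>q. card (?good q)"] bound
  obtain q where q: "transition_system q"
    and max: "\<And>q'. transition_system q' \<Longrightarrow> card (?good q') \<le> card (?good q)"
    by blast
  have "\<not> improvable q T" if "mixed T" "\<not> good q T" for T
  proof
    assume "improvable q T"
    then obtain q' where q': "transition_system q'" "good q' T" "\<And>T'. \<not> lost q q' T'"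
      unfolding improvable_def by blast
    then have "?good q \<subset> ?good q'" using that unfolding lost_def by blast
    then have "card (?good q) < card (?good q')"
      using finite_good by (rule psubset_card_mono[rotated])
    then show False using max[OF q'(1)] by simp
  qed
  then show ?thesis using q mixed_good_or_improvable_or_in_cluster[OF q] by blast
qed

section \<open>Clusters are disjoint\<close>

lemma cluster_reverse: "cluster red blue a b c d e \<Longrightarrow> cluster red blue e d c b a"
  unfolding cluster_def using red_sym blue_sym by blast

lemma cluster_distinct:
  assumes "cluster red blue a b c d e"
  shows "distinct [a, b, c, d, e]"
  using assms red_neq blue_neq red_not_blue unfolding cluster_def by auto

lemma cluster_inner:
  assumes cl: "cluster red blue a b c d e" and v: "v \<in> {b, c, d}" and e: "edge v y"
  shows "y \<in> {a, b, c, d, e}"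
proof -
  have dist: "distinct [a, b, c, d, e]" by (rule cluster_distinct[OF cl])
  have red: "red b a" "red b c" "red c b" "red c d" "red d c" "red d e"
    and blue: "blue b d" "blue b e" "blue c a" "blue c e" "blue d a" "blue d b"
    using cl red_sym blue_sym unfolding cluster_def by blast+
  consider (b) "v = b" | (c) "v = c" | (d) "v = d" using v by blast
  then show ?thesis
  proof cases
    case b
    then show ?thesis using red_saturated[OF red(1,2)] blue_degree[OF blue(1,2)] dist e by auto
  next
    case c
    then show ?thesis using red_saturated[OF red(3,4)] blue_degree[OF blue(3,4)] dist e by auto
  next
    case d
    then show ?thesis using red_saturated[OF red(5,6)] blue_degree[OF blue(5,6)] dist e by auto
  qed
qed

lemma cluster_end:
  assumes cl: "cluster red blue a b c d e" and t: "edge a y" "edge y z" "edge a z"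
  shows "y \<in> {a, b, c, d, e}"
proof (rule ccontr)
  assume y: "y \<notin> {a, b, c, d, e}"
  have dist: "distinct [a, b, c, d, e]" by (rule cluster_distinct[OF cl])
  have a: "red a b" "blue a c" "blue a d" using cl blue_sym unfolding cluster_def by blast+
  have "red a y" using blue_saturated[OF a(2,3) _ t(1)] y dist by auto
  then have "z \<in> {b, c, d}"
    using blue_saturated[OF a(2,3) _ t(3)] red_degree[OF a(1), of y z] y dist t(2) edge_neq by auto
  then show False using cluster_inner[OF cl _ edge_sym[OF t(2)]] y by blast
qed

lemma cluster_closed:
  assumes cl: "cluster red blue a b c d e" and v: "v \<in> {a, b, c, d, e}"
    and t: "edge v y" "edge y z" "edge v z"
  shows "y \<in> {a, b, c, d, e}"
proof -
  consider (a) "v = a" | (e) "v = e" | (inner) "v \<in> {b, c, d}" using v by blast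
  then show ?thesis
  proof cases
    case a
    then show ?thesis using cluster_end[OF cl] t by blast
  next
    case e
    then show ?thesis using cluster_end[OF cluster_reverse[OF cl]] t by blast
  next
    case inner
    then show ?thesis using cluster_inner[OF cl] t by blast
  qed
qed

lemma is_cluster_closed:
  assumes K: "is_cluster K" "v \<in> K" and t: "edge v y" "edge y z" "edge v z"
  shows "y \<in> K"
  using K cluster_closed[OF _ _ t]
    matching_pair.cluster_closed[OF matching_pair_commute, unfolded swapped, OF _ _ t]
  unfolding is_cluster_def by blast

lemma is_cluster_subset:
  assumes K: "is_cluster K" and K': "is_cluster K'" and v: "v \<in> K" "v \<in> K'"
  shows "K \<subseteq> K'"
proof -
  obtain a b c d e where K_eq: "K = {a, b, c, d, e}"
    and "cluster red blue a b c d e \<or> cluster blue red a b c d e"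
    using K unfolding is_cluster_def by blast
  then have edges: "edge a b" "edge b c" "edge a c" "edge c d" "edge b d" "edge d e" "edge c e"
    unfolding cluster_def using red_edge blue_edge by blast+
  note edges' = edges[THEN edge_sym]
  have "a \<in> K' \<longleftrightarrow> b \<in> K'" "b \<in> K' \<longleftrightarrow> c \<in> K'" "c \<in> K' \<longleftrightarrow> d \<in> K'" "d \<in> K' \<longleftrightarrow> e \<in> K'"
    using is_cluster_closed[OF K'] edges edges' by blast+
  then show ?thesis using v K_eq by blast
qed

lemma is_cluster_unique: "\<lbrakk>is_cluster K; is_cluster K'; v \<in> K; v \<in> K'\<rbrakk> \<Longrightarrow> K = K'"
  using is_cluster_subset[of K K' v] is_cluster_subset[of K' K v] by blast

lemma mixed_subset_cluster:
  assumes T: "mixed T" and K: "is_cluster K" "v \<in> K" "v \<in> T"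
  shows "T \<subseteq> K"
proof
  fix y assume y: "y \<in> T"
  obtain u a b where uab: "T = {u, a, b}" "opposite u a b" using T unfolding mixed_def by blast
  have "\<exists>z\<in>T. z \<noteq> v \<and> z \<noteq> y" using opposite_distinct[OF uab(2)] uab(1) by auto
  then show "y \<in> K"
    using is_cluster_closed[OF K(1,2)] mixed_edge[OF T] K y by (cases "y = v") metis+
qed

end

section \<open>Walks following a transition system\<close>

lemma walk_edges_simps:
  "walk_edges [] = []" "walk_edges [x] = []"
  "walk_edges (x # y # us) = {x, y} # walk_edges (y # us)"
  by (simp_all add: walk_edges_def)

lemma length_walk_edges: "length (walk_edges us) = length us - 1"
  by (simp add: walk_edges_def)

lemma nth_walk_edges: "Suc i < length us \<Longrightarrow> walk_edges us ! i = {us ! i, us ! Suc i}"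
  by (simp add: walk_edges_def nth_tl)

lemma walk_edges_append: "walk_edges (us @ x # vs) = walk_edges (us @ [x]) @ walk_edges (x # vs)"
  by (induction us rule: induct_list012) (cases vs, simp_all add: walk_edges_simps)

lemma walk_edges_rev: "walk_edges (rev us) = rev (walk_edges us)"
proof (induction us rule: induct_list012)
  case (3 x y us)
  then show ?case
    using walk_edges_append[of "rev us" y "[x]"] by (simp add: walk_edges_simps insert_commute)
qed (simp_all add: walk_edges_simps)

lemma in_walk_edges_iff:
  "e \<in> set (walk_edges us) \<longleftrightarrow> (\<exists>vs x y ws. us = vs @ x # y # ws \<and> e = {x, y})"
proof
  show "e \<in> set (walk_edges us) \<Longrightarrow> \<exists>vs x y ws. us = vs @ x # y # ws \<and> e = {x, y}"
  proof (induction us rule: induct_list012)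
    case (3 a b us)
    then consider "e = {a, b}" | "e \<in> set (walk_edges (b # us))" by (auto simp: walk_edges_simps)
    then show ?case using 3(2) by cases (metis append_Nil append_Cons)+
  qed (simp_all add: walk_edges_simps)
next
  assume "\<exists>vs x y ws. us = vs @ x # y # ws \<and> e = {x, y}"
  then obtain vs x y ws where "us = vs @ x # y # ws" "e = {x, y}" by blast
  then show "e \<in> set (walk_edges us)"
    using walk_edges_append[of vs x "y # ws"] by (simp add: walk_edges_simps)
qed

lemma set_walk_edges_append: "set (walk_edges us) \<subseteq> set (walk_edges (us @ vs))"
proof
  fix e assume "e \<in> set (walk_edges us)"
  then obtain as x y bs where "us = as @ x # y # bs" "e = {x, y}"
    unfolding in_walk_edges_iff by blast
  then have "us @ vs = as @ x # y # (bs @ vs) \<and> e = {x, y}" by simp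
  then show "e \<in> set (walk_edges (us @ vs))" unfolding in_walk_edges_iff by blast
qed

lemma walk_edges_nonemptyE:
  assumes "walk_edges us \<noteq> []"
  obtains x y vs where "us = x # y # vs"
  using assms by (induction us rule: induct_list012) (simp_all add: walk_edges_simps)

fun transition_walk :: "('a \<Rightarrow> 'a \<Rightarrow> 'a \<Rightarrow> bool) \<Rightarrow> 'a list \<Rightarrow> bool" where
  "transition_walk q (x # u # y # us) \<longleftrightarrow> q u x y \<and> transition_walk q (u # y # us)"
| "transition_walk q us \<longleftrightarrow> True"

lemma transition_walk_ConsD: "transition_walk q (x # us) \<Longrightarrow> transition_walk q us"
  by (cases "(q, x # us)" rule: transition_walk.cases) simp_all

lemma transition_walk_appendD: "transition_walk q (vs @ us) \<Longrightarrow> transition_walk q us"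
  by (induction vs) (auto dest: transition_walk_ConsD)

lemma transition_walk_nth:
  "\<lbrakk>transition_walk q us; Suc (Suc i) < length us\<rbrakk> \<Longrightarrow> q (us ! Suc i) (us ! i) (us ! Suc (Suc i))"
  by (induction q us arbitrary: i rule: transition_walk.induct)
    (auto simp: nth_Cons split: nat.split)

lemma transition_walk_snoc:
  "transition_walk q (us @ [x, u, y]) \<longleftrightarrow> transition_walk q (us @ [x, u]) \<and> q u x y"
  by (induction q us rule: transition_walk.induct) auto

lemma transition_walk_rev:
  assumes "\<And>u x y. q u x y \<Longrightarrow> q u y x"
  shows "transition_walk q us \<Longrightarrow> transition_walk q (rev us)"
  using assms by (induction q us rule: transition_walk.induct) (auto simp: transition_walk_snoc)

definition link :: "'a set \<Rightarrow> ('a \<Rightarrow> 'a \<Rightarrow> 'a \<Rightarrow> bool) \<Rightarrow> ('a set \<times> 'a set) set" where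
  "link K q = {({u, x}, {u, y}) | u x y. u \<in> K \<and> q u x y}"

lemma linkI: "\<lbrakk>u \<in> K; q u x y\<rbrakk> \<Longrightarrow> ({u, x}, {u, y}) \<in> link K q"
  unfolding link_def by blast

lemma link_mono: "(\<And>v. v \<in> K \<Longrightarrow> q v = q' v) \<Longrightarrow> link K q \<subseteq> link UNIV q'"
  unfolding link_def by fastforce

lemma transition_walk_linked:
  "\<lbrakk>transition_walk q (x # y # us); set (x # y # us) \<subseteq> K; e \<in> set (walk_edges (x # y # us))\<rbrakk>
    \<Longrightarrow> ({x, y}, e) \<in> (link K q)\<^sup>*"
proof (induction us arbitrary: x y)
  case (Cons z us)
  show ?case
  proof (cases "e = {x, y}")
    case False
    then have "({y, z}, e) \<in> (link K q)\<^sup>*" using Cons by (auto simp: walk_edges_simps)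
    moreover have "({y, x}, {y, z}) \<in> link K q" using Cons.prems by (intro linkI) auto
    ultimately show ?thesis by (simp add: insert_commute converse_rtrancl_into_rtrancl)
  qed simp
qed (simp add: walk_edges_simps)

context matching_pair
begin

lemma sym_link:
  assumes "\<And>v. v \<in> K \<Longrightarrow> transitions_at v (q v)"
  shows "sym (link K q)"
  unfolding sym_def link_def using transition_sym[OF assms] by fastforce

lemma sym_link_system: "transition_system q \<Longrightarrow> sym (link UNIV q)"
  by (rule sym_link) (rule transition_systemD)

lemma transition_walk_edges_linked:
  assumes K: "\<And>v. v \<in> K \<Longrightarrow> transitions_at v (q v)"
    and us: "transition_walk q us" "set us \<subseteq> K"
    and "e \<in> set (walk_edges us)" "f \<in> set (walk_edges us)"
  shows "(e, f) \<in> (link K q)\<^sup>*"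
proof -
  have "walk_edges us \<noteq> []" using assms(4) by auto
  then obtain x y vs where us_eq: "us = x # y # vs" by (rule walk_edges_nonemptyE)
  note from_first = transition_walk_linked[OF us[unfolded us_eq]]
  have "({x, y}, e) \<in> (link K q)\<^sup>*" "({x, y}, f) \<in> (link K q)\<^sup>*"
    using from_first assms(4,5) unfolding us_eq by blast+
  then show ?thesis
    using symD[OF sym_rtrancl[OF sym_link[OF K]]] rtrancl_trans by metis
qed

lemma linked_coloured:
  assumes q: "transition_system q" and "(e, f) \<in> (link UNIV q)\<^sup>*" "e \<in> coloured UNIV"
  shows "f \<in> coloured UNIV"
proof -
  have step: "f' \<in> coloured UNIV" if "(e', f') \<in> link UNIV q" for e' f'
    using that transition_opposite[OF transition_systemD[OF q]]
    unfolding link_def coloured_def opposite_def by blast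
  show ?thesis using assms(2,3) by (induction rule: rtrancl_induct) (use step in blast)+
qed

lemma inextensible_walk_closed:
  assumes q: "transition_system q" and us: "transition_walk q us" "distinct (walk_edges us)"
    and inextensible: "\<And>z. transition_walk q (us @ [z]) \<Longrightarrow> \<not> distinct (walk_edges (us @ [z]))"
    and eq: "us = vs @ x # u # ws" and y: "q u x y"
  shows "{u, y} \<in> set (walk_edges us)"
proof (cases ws)
  case Nil
  then have "transition_walk q (us @ [y])"
    using us(1) y eq transition_walk_snoc[of q vs x u y] by simp
  moreover have "walk_edges (us @ [y]) = walk_edges us @ [{u, y}]"
    using walk_edges_append[of "vs @ [x]" u "[y]"] eq Nil by (simp add: walk_edges_simps)
  ultimately show ?thesis using us(2) inextensible by fastforce
next
  case (Cons z ws')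
  then have "q u x z" using us(1) eq transition_walk_appendD[of q vs "x # u # z # ws'"] by simp
  then have "z = y" using transition_unique[OF transition_systemD[OF q]] y by blast
  then have "us = (vs @ [x]) @ u # y # ws'" using eq Cons by simp
  then show ?thesis unfolding in_walk_edges_iff by blast
qed

lemma longest_walk_closed:
  assumes q: "transition_system q" and us: "transition_walk q us" "distinct (walk_edges us)"
    and longest: "\<And>vs. \<lbrakk>transition_walk q vs; distinct (walk_edges vs);
      set (walk_edges us) \<subseteq> set (walk_edges vs)\<rbrakk> \<Longrightarrow> length vs \<le> length us"
    and ef: "e \<in> set (walk_edges us)" "(e, f) \<in> link UNIV q"
  shows "f \<in> set (walk_edges us)"
proof -
  have sym: "q u x y \<Longrightarrow> q u y x" for u x y using transition_sym[OF transition_systemD[OF q]] .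
  have closed: "{u, y} \<in> set (walk_edges vs)"
    if vs: "vs = us \<or> vs = rev us" and "vs = as @ x # u # bs" "q u x y" for vs as x u bs y
  proof (rule inextensible_walk_closed[OF q _ _ _ that(2,3)])
    show "transition_walk q vs" "distinct (walk_edges vs)"
      using vs us transition_walk_rev[of q us] sym by (auto simp: walk_edges_rev)
    have "set (walk_edges us) \<subseteq> set (walk_edges (vs @ [z]))" for z
      using vs set_walk_edges_append[of vs "[z]"] by (auto simp: walk_edges_rev)
    then show "\<not> distinct (walk_edges (vs @ [z]))" if "transition_walk q (vs @ [z])" for z
      using longest[OF that] vs by fastforce
  qed
  obtain u x y where uxy: "e = {u, x}" "f = {u, y}" "q u x y"
    using ef(2) unfolding link_def by blast
  obtain vs a b ws where us_eq: "us = vs @ a # b # ws" "e = {a, b}"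
    using ef(1) unfolding in_walk_edges_iff by blast
  then have rev_eq: "rev us = rev ws @ b # a # rev vs" by simp
  from us_eq(2) uxy(1) consider (forward) "a = x" "b = u" | (backward) "a = u" "b = x"
    by (auto simp: doubleton_eq_iff)
  then show ?thesis
  proof cases
    case forward
    then show ?thesis using closed[of us] us_eq(1) uxy by blast
  next
    case backward
    then have "f \<in> set (walk_edges (rev us))" using closed[of "rev us"] rev_eq uxy by blast
    then show ?thesis by (simp add: walk_edges_rev)
  qed
qed

lemma class_is_trail:
  assumes fin: "finite (coloured UNIV)" and q: "transition_system q" and e: "e \<in> coloured UNIV"
  obtains us where "transition_walk q us" "distinct (walk_edges us)"
    "set (walk_edges us) = (link UNIV q)\<^sup>* `` {e}"
proof -
  let ?P = "\<lambda>us. transition_walk q us \<and> distinct (walk_edges us) \<and> e \<in> set (walk_edges us)"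
  have linked: "set (walk_edges us) \<subseteq> (link UNIV q)\<^sup>* `` {e}" if "?P us" for us
    using that transition_walk_edges_linked[of UNIV q us e] transition_systemD[OF q] by auto
  have "length us < Suc (Suc (card (coloured UNIV)))" if "?P us" for us
  proof -
    have "set (walk_edges us) \<subseteq> coloured UNIV"
      using linked[OF that] linked_coloured[OF q _ e] by blast
    then have "card (set (walk_edges us)) \<le> card (coloured UNIV)" by (rule card_mono[OF fin])
    then show ?thesis using that distinct_card[of "walk_edges us"] by (simp add: length_walk_edges)
  qed
  moreover obtain x y where "e = {x, y}" using e unfolding coloured_def by blast
  then have "?P [x, y]" by (simp add: walk_edges_simps)
  ultimately obtain us where us: "?P us" and longest: "\<And>vs. ?P vs \<Longrightarrow> length vs \<le> length us"
    using ex_has_greatest_nat[of ?P "[x, y]" length] by blast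
  have "f \<in> set (walk_edges us)" if "(e, f) \<in> (link UNIV q)\<^sup>*" for f
    using that
  proof (induction rule: rtrancl_induct)
    case (step f g)
    have "length vs \<le> length us" if "transition_walk q vs" "distinct (walk_edges vs)"
        "set (walk_edges us) \<subseteq> set (walk_edges vs)" for vs
      using longest us that by blast
    then show ?case using longest_walk_closed[OF q] us step by blast
  qed (use us in blast)
  then show ?thesis using that us linked[OF us] by blast
qed

end

section \<open>Putting each cluster on one trail\<close>

context matching_pair
begin

definition unifies :: "('a \<Rightarrow> 'a \<Rightarrow> 'a \<Rightarrow> bool) \<Rightarrow> 'a set \<Rightarrow> bool" where
  "unifies m K \<longleftrightarrow> (\<forall>v\<in>K. transitions_at v (m v)) \<and> coloured K \<times> coloured K \<subseteq> (link K m)\<^sup>*"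

lemma cluster_coloured:
  assumes cl: "cluster red blue a b c d e" and f: "f \<in> coloured {a, b, c, d, e}"
  shows "f \<in> {{e, b}, {b, a}, {a, c}, {c, b}, {b, d}, {d, c}, {c, e}, {e, d}, {d, a}} \<or>
    f = {a, e} \<and> red a e"
proof -
  obtain v w where f_eq: "f = {v, w}" and vw: "v \<in> {a, b, c, d, e}" "w \<in> {a, b, c, d, e}"
    and coloured: "red v w \<or> blue v w"
    using f by (rule colouredE)
  have "v \<noteq> w" using coloured red_neq blue_neq by blast
  with vw have "f = {a, e} \<or>
      f \<in> {{e, b}, {b, a}, {a, c}, {c, b}, {b, d}, {d, c}, {c, e}, {e, d}, {d, a}}"
    unfolding f_eq by (elim insertE emptyE) (simp_all add: doubleton_eq_iff)
  moreover have "\<not> blue a e"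
    using cl cluster_distinct[OF cl] blue_degree[of a c d e] blue_sym[of d a]
    unfolding cluster_def by auto
  then have "red a e" if "f = {a, e}"
    using that coloured red_sym blue_sym unfolding f_eq doubleton_eq_iff by blast
  ultimately show ?thesis by metis
qed

lemma cluster_unifies:
  assumes cl: "cluster red blue a b c d e"
  shows "\<exists>m. unifies m {a, b, c, d, e}"
proof -
  let ?K = "{a, b, c, d, e}"
  have dist: "distinct [a, b, c, d, e]" by (rule cluster_distinct[OF cl])
  have red: "red a b" "red b c" "red c d" "red d e" "red b a" "red c b" "red d c" "red e d"
    and blue: "blue a c" "blue c e" "blue e b" "blue b d" "blue d a"
      "blue c a" "blue e c" "blue b e" "blue d b" "blue a d"
    using cl red_sym blue_sym unfolding cluster_def by blast+
  \<comment> \<open>\<open>m\<close> is read off the walk \<open>us\<close> below.\<close>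
  define m where "m = undefined(a := through a b c, b := through b c d, c := through c d e,
    d := through d e a, e := through e d c)"
  have m: "m a = through a b c" "m b = through b c d" "m c = through c d e" "m d = through d e a"
    "m e = through e d c"
    unfolding m_def using dist by auto
  have transitions: "transitions_at v (m v)" if "v \<in> ?K" for v
    using that red blue by (auto simp: m opposite_def intro!: transitions_at_through)
  define us where "us = [e, b, a, c, b, d, c, e, d, a] @ (if red a e then [e] else [])"
  have "transition_walk m us"
    using dist cluster_distinct[OF cluster_reverse[OF cl]] red blue red_sym[of a e]
    by (simp add: us_def m through_def opposite_def)
  moreover have "set us \<subseteq> ?K" by (auto simp: us_def)
  moreover have "coloured ?K \<subseteq> set (walk_edges us)"
  proof
    fix f assume "f \<in> coloured ?K"
    from cluster_coloured[OF cl this] show "f \<in> set (walk_edges us)"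
      by (elim disjE conjE insertE emptyE) (simp_all add: us_def walk_edges_simps)
  qed
  ultimately have "coloured ?K \<times> coloured ?K \<subseteq> (link ?K m)\<^sup>*"
    using transition_walk_edges_linked[OF transitions] by blast
  then show ?thesis using transitions unfolding unifies_def by blast
qed

lemma swapped_unifies: "matching_pair.unifies N M = unifies"
  unfolding matching_pair.unifies_def[OF matching_pair_commute] unifies_def swapped ..

lemma is_cluster_unifies:
  assumes "is_cluster K"
  shows "\<exists>m. unifies m K"
proof -
  obtain a b c d e where K: "K = {a, b, c, d, e}"
    and "cluster red blue a b c d e \<or> cluster blue red a b c d e"
    using assms unfolding is_cluster_def by blast
  then show ?thesis
    using cluster_unifies[of a b c d e]
      matching_pair.cluster_unifies[OF matching_pair_commute, of a b c d e]
    unfolding K swapped_unifies by blast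
qed

definition connects :: "('a \<Rightarrow> 'a \<Rightarrow> 'a \<Rightarrow> bool) \<Rightarrow> 'a set \<Rightarrow> bool" where
  "connects q T \<longleftrightarrow> (\<exists>x y v w. {x, y, v, w} \<subseteq> T \<and> red x y \<and> blue v w \<and>
     ({x, y}, {v, w}) \<in> (link UNIV q)\<^sup>*)"

lemma connectsI:
  assumes q: "transition_system q" and opp: "opposite u a b"
    and linked: "({u, a}, {u, b}) \<in> (link UNIV q)\<^sup>*"
  shows "connects q {u, a, b}"
proof -
  have linked': "({u, b}, {u, a}) \<in> (link UNIV q)\<^sup>*"
    using symD[OF sym_rtrancl[OF sym_link_system[OF q]] linked] .
  from opp consider (red_blue) "red u a" "blue u b" | (blue_red) "red u b" "blue u a"
    unfolding opposite_def by blast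
  then show ?thesis
  proof cases
    case red_blue
    then show ?thesis
      unfolding connects_def using linked
      by (intro exI[of _ u] exI[of _ a] exI[of _ b] conjI) simp_all
  next
    case blue_red
    then show ?thesis
      unfolding connects_def using linked'
      by (intro exI[of _ u] exI[of _ a] exI[of _ b] conjI) simp_all
  qed
qed

lemma connects_if_unified:
  assumes p: "transition_system p" and T: "mixed T" "T \<subseteq> K"
    and m: "unifies m K" "\<And>v. v \<in> K \<Longrightarrow> m v = p v"
  shows "connects p T"
proof -
  obtain u a b where uab: "T = {u, a, b}" "opposite u a b" using T(1) unfolding mixed_def by metis
  then have "{u, a} \<in> coloured K" "{u, b} \<in> coloured K"
    using T(2) unfolding opposite_def by (auto intro!: colouredI)
  then have "({u, a}, {u, b}) \<in> (link K m)\<^sup>*" using m(1) unfolding unifies_def by auto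
  then have "({u, a}, {u, b}) \<in> (link UNIV p)\<^sup>*"
    using rtrancl_mono[OF link_mono[of K m p]] m(2) by auto
  then show ?thesis using connectsI[OF p uab(2)] uab(1) by simp
qed

lemma connects_if_good:
  assumes q: "transition_system q" and "good q T"
  shows "connects q T"
proof -
  obtain u a b where uab: "T = {u, a, b}" "q u a b" using assms(2) unfolding good_def by metis
  then have "({u, a}, {u, b}) \<in> (link UNIV q)\<^sup>*" by (simp add: linkI r_into_rtrancl)
  then show ?thesis
    using connectsI[OF q] transition_opposite[OF transition_systemD[OF q] uab(2)] uab(1) by simp
qed

lemma transition_system_unifying_clusters:
  assumes q: "transition_system q"
  obtains p where "transition_system p"
    "\<And>K. is_cluster K \<Longrightarrow> \<exists>m. unifies m K \<and> (\<forall>v\<in>K. m v = p v)"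
    "\<And>v. \<nexists>K. is_cluster K \<and> v \<in> K \<Longrightarrow> p v = q v"
proof -
  obtain m where m: "\<And>K. is_cluster K \<Longrightarrow> unifies (m K) K"
    using is_cluster_unifies by metis
  define p where "p v = (if \<exists>K. is_cluster K \<and> v \<in> K
    then m (THE K. is_cluster K \<and> v \<in> K) v else q v)" for v
  have p_in: "m K v = p v" if "is_cluster K" "v \<in> K" for v K
  proof -
    have "(THE K. is_cluster K \<and> v \<in> K) = K"
      using that is_cluster_unique by (intro the_equality) blast+
    then show ?thesis using that unfolding p_def by auto
  qed
  have p_out: "p v = q v" if "\<nexists>K. is_cluster K \<and> v \<in> K" for v
    using that unfolding p_def by auto
  have "transitions_at v (p v)" for v
  proof (cases "\<exists>K. is_cluster K \<and> v \<in> K")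
    case True
    then show ?thesis using p_in m unfolding unifies_def by metis
  next
    case False
    then show ?thesis using p_out transition_systemD[OF q] by simp
  qed
  then have "transition_system p" unfolding transition_system_def by blast
  then show ?thesis using that m p_in p_out by metis
qed

lemma connecting_transition_system:
  assumes fin: "finite (coloured UNIV)"
  obtains p where "transition_system p" "\<And>T. mixed T \<Longrightarrow> connects p T"
proof -
  obtain q where q: "transition_system q"
    and outside: "\<And>T. mixed T \<Longrightarrow> good q T \<or> in_cluster T"
    using transition_system_good_outside_clusters[OF fin] by blast
  obtain p where p: "transition_system p"
    and p_in: "\<And>K. is_cluster K \<Longrightarrow> \<exists>m. unifies m K \<and> (\<forall>v\<in>K. m v = p v)"
    and p_out: "\<And>v. \<nexists>K. is_cluster K \<and> v \<in> K \<Longrightarrow> p v = q v"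
    using transition_system_unifying_clusters[OF q] by metis
  have "connects p T" if T: "mixed T" for T
  proof (cases "\<exists>K v. is_cluster K \<and> v \<in> K \<and> v \<in> T")
    case True
    then obtain K v where K: "is_cluster K" "v \<in> K" "v \<in> T" by blast
    then have "T \<subseteq> K" by (rule mixed_subset_cluster[OF T])
    then show ?thesis using connects_if_unified[OF p T] p_in[OF K(1)] by metis
  next
    case False
    have "T \<noteq> {}" using T unfolding mixed_def by auto
    then have "\<not> in_cluster T" using False unfolding in_cluster_def by blast
    then obtain u a b where uab: "T = {u, a, b}" "q u a b"
      using outside[OF T] unfolding good_def by metis
    then have "p u = q u" using p_out[of u] False by blast
    then have "p u a b" using uab(2) by simp
    then show ?thesis using connects_if_good[OF p goodI] uab(1) by simp
  qed
  then show ?thesis using that p by blast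
qed

end

section \<open>Switching along a trail\<close>

definition switch :: "'a set set \<Rightarrow> ('a \<Rightarrow> 'a \<Rightarrow> bool) \<Rightarrow> 'a \<Rightarrow> 'a \<Rightarrow> bool" where
  "switch P M x y \<longleftrightarrow> M x y \<noteq> ({x, y} \<in> P)"

context matching_pair
begin

lemma switch_edge:
  assumes "P \<subseteq> coloured UNIV" "switch P M x y"
  shows "edge x y"
proof -
  have "red x y \<or> blue x y" if "{x, y} \<in> P"
    using subsetD[OF assms(1) that] by (rule coloured_colour)
  then show ?thesis using assms(2) red_edge blue_edge unfolding switch_def edge_def by blast
qed

context
  fixes q P
  assumes q: "transition_system q" and P: "P \<subseteq> coloured UNIV" and closed: "link UNIV q `` P \<subseteq> P"
begin

lemma switch_not_matched:
  assumes "switch P M v c" "switch P M v d"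
  shows "\<not> q v c d"
proof
  note q_v = transition_systemD[OF q, of v]
  assume cd: "q v c d"
  then have "opposite v c d" by (rule transition_opposite[OF q_v])
  moreover have "{v, c} \<in> P \<longleftrightarrow> {v, d} \<in> P"
    using closed linkI[of v UNIV q] cd transition_sym[OF q_v] by blast
  ultimately show False using assms unfolding switch_def opposite_def exclusive_def by blast
qed

lemma switch_opposite_unique:
  assumes ab: "switch P M v a" "switch P M v b" "opposite v a b" and y: "switch P M v y"
  shows "y = a \<or> y = b"
proof (rule ccontr)
  assume neq: "\<not> ?thesis"
  note q_v = transition_systemD[OF q, of v]
  have "\<not> opposite v a y"
    using transition_complement[OF q_v ab(3), of y] switch_not_matched ab y neq by blast
  moreover have "\<not> opposite v b y"
    using transition_complement[OF q_v opposite_sym[OF ab(3)], of y] switch_not_matched ab y neq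
    by blast
  ultimately have common: "M v y" "N v y"
    using switch_edge[OF P y] ab(3) unfolding edge_def opposite_def exclusive_def by blast+
  have "\<And>c. opposite v a c \<Longrightarrow> c = b" "\<And>c. opposite v b c \<Longrightarrow> c = a"
    using ab(3) neq common M.degree[of v y] N.degree[of v y]
    unfolding opposite_def exclusive_def by blast+
  then have "q v a b" by (rule transition_forced[OF q_v ab(3)])
  then show False using switch_not_matched ab by blast
qed

lemma switch_degree:
  assumes s: "switch P M v a" "switch P M v b" "switch P M v c"
  shows "a = b \<or> a = c \<or> b = c"
proof -
  consider (M) "M v a" "M v b" "M v c" | (N) "N v a" "N v b" "N v c"
    | (ab) "opposite v a b" | (ac) "opposite v a c" | (bc) "opposite v b c"
    using s[THEN switch_edge[OF P]] unfolding edge_def opposite_def exclusive_def by blast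
  then show ?thesis
  proof cases
    case M
    then show ?thesis by (rule M.degree)
  next
    case N
    then show ?thesis by (rule N.degree)
  next
    case ab
    then show ?thesis using switch_opposite_unique[OF s(1,2) _ s(3)] by blast
  next
    case ac
    then show ?thesis using switch_opposite_unique[OF s(1,3) _ s(2)] by blast
  next
    case bc
    then show ?thesis using switch_opposite_unique[OF s(2,3) _ s(1)] by blast
  qed
qed

lemma linked_in_iff: "(e, f) \<in> (link UNIV q)\<^sup>* \<Longrightarrow> f \<in> P \<longleftrightarrow> e \<in> P"
proof (induction rule: rtrancl_induct)
  case (step f g)
  then show ?case using closed symD[OF sym_link_system[OF q]] by blast
qed simp

lemma switch_sym: "switch P M x y \<Longrightarrow> switch P M y x"
  unfolding switch_def using M.adj_sym by (auto simp: insert_commute)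

lemma switch_no_triangle:
  assumes connects: "\<And>T. mixed T \<Longrightarrow> connects q T"
    and s: "switch P M x y" "switch P M y z" "switch P M x z"
  shows False
proof -
  have "mixed {x, y, z}" using s[THEN switch_edge[OF P]] by (rule mixed_triangle)
  then obtain a b c d where abcd: "{a, b, c, d} \<subseteq> {x, y, z}" "red a b" "blue c d"
    "({a, b}, {c, d}) \<in> (link UNIV q)\<^sup>*" using connects unfolding connects_def by metis
  have "switch P M v w" if "v \<in> {x, y, z}" "w \<in> {x, y, z}" "v \<noteq> w" for v w
    using that s s[THEN switch_sym] by blast
  then have "switch P M a b" "switch P M c d"
    using abcd(1) red_neq[OF abcd(2)] blue_neq[OF abcd(3)] by simp_all
  then have "{a, b} \<notin> P" "{c, d} \<in> P"
    using abcd(2,3) unfolding switch_def exclusive_def by blast+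
  then show False using linked_in_iff[OF abcd(4)] by blast
qed

lemma triangle_free_2_matching_switch:
  assumes "\<And>T. mixed T \<Longrightarrow> connects q T"
  shows "triangle_free_2_matching (switch P M)"
  by unfold_locales (use switch_sym switch_degree switch_no_triangle[OF assms] in blast)+

end

lemma connects_swapped:
  assumes q: "transition_system q" and "connects q T"
  shows "matching_pair.connects N M q T"
proof -
  obtain x y v w where xyvw: "{x, y, v, w} \<subseteq> T" "red x y" "blue v w"
    and linked: "({x, y}, {v, w}) \<in> (link UNIV q)\<^sup>*"
    using assms(2) unfolding connects_def by metis
  have "({v, w}, {x, y}) \<in> (link UNIV q)\<^sup>*"
    using symD[OF sym_rtrancl[OF sym_link_system[OF q]] linked] .
  moreover have "{v, w, x, y} \<subseteq> T" using xyvw(1) by simp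
  ultimately show ?thesis
    unfolding matching_pair.connects_def[OF matching_pair_commute] using xyvw(2,3) by metis
qed

lemma triangle_free_2_matching_switch_both:
  assumes q: "transition_system q" and P: "P \<subseteq> coloured UNIV" "link UNIV q `` P \<subseteq> P"
    and connects: "\<And>T. mixed T \<Longrightarrow> connects q T"
  shows "triangle_free_2_matching (switch P M)" and "triangle_free_2_matching (switch P N)"
proof -
  show "triangle_free_2_matching (switch P M)"
    using q P connects by (rule triangle_free_2_matching_switch)
  show "triangle_free_2_matching (switch P N)"
    using matching_pair_commute
  proof (rule matching_pair.triangle_free_2_matching_switch)
    show "matching_pair.connects N M q T" if "matching_pair.mixed N M T" for T
      using that connects connects_swapped[OF q] by (simp add: swapped)
  qed (use q P in \<open>simp_all add: swapped\<close>)
qed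

lemma trail_partition:
  assumes fin: "finite (coloured UNIV)"
  obtains q \<P> where "transition_system q" "partition_on (coloured UNIV) \<P>"
    "\<forall>P\<in>\<P>. \<exists>us. transition_walk q us \<and> distinct (walk_edges us) \<and> set (walk_edges us) = P"
    "\<forall>P\<in>\<P>. triangle_free_2_matching (switch P M) \<and> triangle_free_2_matching (switch P N)"
proof -
  let ?D = "coloured UNIV"
  obtain q where q: "transition_system q" and connects: "\<And>T. mixed T \<Longrightarrow> connects q T"
    using connecting_transition_system[OF fin] by blast
  let ?linked = "(link UNIV q)\<^sup>*"
  define r where "r = ?linked \<inter> ?D \<times> ?D"
  have "equiv ?D r"
  proof (rule equivI)
    show "sym r"
      using symD[OF sym_rtrancl[OF sym_link_system[OF q]]] unfolding sym_def r_def by blast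
    show "trans r" unfolding trans_def r_def by (auto intro: rtrancl_trans)
  qed (auto simp: r_def refl_on_def)
  then have "partition_on ?D (?D // r)" by (rule partition_on_quotient)
  moreover have "(\<exists>us. transition_walk q us \<and> distinct (walk_edges us) \<and> set (walk_edges us) = P) \<and>
      triangle_free_2_matching (switch P M) \<and> triangle_free_2_matching (switch P N)"
    if quotient: "P \<in> ?D // r" for P
  proof -
    obtain e where e: "e \<in> ?D" "P = r `` {e}" using quotient by (rule quotientE)
    then have P: "P = ?linked `` {e}" using linked_coloured[OF q] unfolding r_def by blast
    have "P \<subseteq> ?D" unfolding e(2) r_def by blast
    moreover have "link UNIV q `` P \<subseteq> P"
      unfolding P by (auto intro: rtrancl_into_rtrancl)
    ultimately show ?thesis
      using class_is_trail[OF fin q e(1)] triangle_free_2_matching_switch_both[OF q _ _ connects] P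
      by metis
  qed
  ultimately show ?thesis using that[OF q] by blast
qed

end

section \<open>Edge sets of simple graphs\<close>

definition adj :: "'a set set \<Rightarrow> 'a \<Rightarrow> 'a \<Rightarrow> bool" where
  "adj A x y \<longleftrightarrow> {x, y} \<in> A"

lemma exclusive_adj: "exclusive (adj A) (adj B) x y \<longleftrightarrow> {x, y} \<in> A - B"
  by (simp add: exclusive_def adj_def)

lemma switch_adj: "switch P (adj A) = adj (sym_diff A P)"
  by (auto simp: switch_def adj_def fun_eq_iff)

lemma simple_graph_finite: "simple_graph V E \<Longrightarrow> finite E"
  unfolding simple_graph_def by (rule finite_subset[of _ "Pow V"]) auto

lemma simple_graph_edgeE:
  assumes "simple_graph V E" "e \<in> E" "v \<in> e"
  obtains w where "e = {v, w}" "v \<noteq> w" "v \<in> V"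
  using assms unfolding simple_graph_def by blast

lemma card_le_2_iff:
  assumes "finite S"
  shows "card S \<le> 2 \<longleftrightarrow> (\<forall>a b c. a \<in> S \<longrightarrow> b \<in> S \<longrightarrow> c \<in> S \<longrightarrow> a = b \<or> a = c \<or> b = c)"
proof
  assume le: "card S \<le> 2"
  show "\<forall>a b c. a \<in> S \<longrightarrow> b \<in> S \<longrightarrow> c \<in> S \<longrightarrow> a = b \<or> a = c \<or> b = c"
  proof (intro allI impI)
    fix a b c assume "a \<in> S" "b \<in> S" "c \<in> S"
    then have "card {a, b, c} \<le> 2" using le card_mono[OF assms, of "{a, b, c}"] by simp
    then show "a = b \<or> a = c \<or> b = c" by (auto simp: card_insert_if split: if_splits)
  qed
next
  assume eq: "\<forall>a b c. a \<in> S \<longrightarrow> b \<in> S \<longrightarrow> c \<in> S \<longrightarrow> a = b \<or> a = c \<or> b = c"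
  show "card S \<le> 2"
  proof (rule ccontr)
    assume "\<not> card S \<le> 2"
    then obtain T where "T \<subseteq> S" "card T = 3" using obtain_subset_with_card_n[of 3 S] by auto
    then show False using eq unfolding card_3_iff by (metis insertCI subsetD)
  qed
qed

lemma two_matching_iff:
  assumes G: "simple_graph V E" and A: "A \<subseteq> E"
  shows "two_matching V E A \<longleftrightarrow>
    (\<forall>v a b c. adj A v a \<longrightarrow> adj A v b \<longrightarrow> adj A v c \<longrightarrow> a = b \<or> a = c \<or> b = c)"
proof -
  have degree: "card {e \<in> A. v \<in> e} \<le> 2 \<longleftrightarrow>
      (\<forall>a b c. adj A v a \<longrightarrow> adj A v b \<longrightarrow> adj A v c \<longrightarrow> a = b \<or> a = c \<or> b = c)" for v
  proof -
    have image: "{e \<in> A. v \<in> e} = (\<lambda>a. {v, a}) ` {a. adj A v a}"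
    proof
      show "{e \<in> A. v \<in> e} \<subseteq> (\<lambda>a. {v, a}) ` {a. adj A v a}"
        using simple_graph_edgeE[OF G] A unfolding adj_def by blast
    qed (auto simp: adj_def)
    have inj: "inj_on (\<lambda>a. {v, a}) {a. adj A v a}"
      by (auto simp: inj_on_def doubleton_eq_iff)
    have "finite {e \<in> A. v \<in> e}" using finite_subset[OF A simple_graph_finite[OF G]] by simp
    then have "finite {a. adj A v a}" unfolding image using inj by (rule finite_imageD)
    then show ?thesis unfolding image card_image[OF inj] by (simp add: card_le_2_iff)
  qed
  have "v \<in> V" if "adj A v a" for v a
    using simple_graph_edgeE[OF G, of "{v, a}" v] that A unfolding adj_def by blast
  then show ?thesis unfolding two_matching_def degree using A by blast
qed

lemma triangle_free_iff:
  assumes G: "simple_graph V E" and A: "A \<subseteq> E"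
  shows "triangle_free A \<longleftrightarrow> (\<forall>x y z. adj A x y \<longrightarrow> adj A y z \<longrightarrow> \<not> adj A x z)"
proof -
  have neq: "x \<noteq> y" if "adj A x y" for x y
    using simple_graph_edgeE[OF G, of "{x, y}" x] that A unfolding adj_def
    by (metis doubleton_eq_iff insertI1 subsetD)
  have "(\<exists>T. is_triangle T \<and> T \<subseteq> A) \<longleftrightarrow> (\<exists>x y z. adj A x y \<and> adj A y z \<and> adj A x z)"
  proof
    assume "\<exists>T. is_triangle T \<and> T \<subseteq> A"
    then obtain x y z where "{{x, y}, {y, z}, {z, x}} \<subseteq> A" unfolding is_triangle_def by metis
    then show "\<exists>x y z. adj A x y \<and> adj A y z \<and> adj A x z"
      unfolding adj_def by (metis insert_commute insert_subset)
  next
    assume "\<exists>x y z. adj A x y \<and> adj A y z \<and> adj A x z"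
    then obtain x y z where xyz: "adj A x y" "adj A y z" "adj A x z" by blast
    then have "is_triangle {{x, y}, {y, z}, {z, x}}"
      using neq unfolding is_triangle_def by (intro exI[of _ x] exI[of _ y] exI[of _ z]) auto
    moreover have "{{x, y}, {y, z}, {z, x}} \<subseteq> A"
      using xyz unfolding adj_def by (simp add: insert_commute)
    ultimately show "\<exists>T. is_triangle T \<and> T \<subseteq> A" by blast
  qed
  then show ?thesis unfolding triangle_free_def by blast
qed

lemma triangle_free_2_matching_adj_iff:
  assumes "simple_graph V E" "A \<subseteq> E"
  shows "triangle_free_2_matching (adj A) \<longleftrightarrow> two_matching V E A \<and> triangle_free A"
proof -
  have "adj A x y \<Longrightarrow> adj A y x" for x y by (simp add: adj_def insert_commute)
  then show ?thesis
    unfolding triangle_free_2_matching_def two_matching_iff[OF assms] triangle_free_iff[OF assms]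
    by blast
qed

locale triangle_free_matchings =
  fixes V :: "'a set" and E A\<^sub>1 A\<^sub>2 :: "'a set set"
  assumes simple: "simple_graph V E"
    and A\<^sub>1: "two_matching V E A\<^sub>1" "triangle_free A\<^sub>1"
    and A\<^sub>2: "two_matching V E A\<^sub>2" "triangle_free A\<^sub>2"
begin

lemma subset_edges: "A\<^sub>1 \<subseteq> E" "A\<^sub>2 \<subseteq> E"
  using A\<^sub>1 A\<^sub>2 unfolding two_matching_def by auto

sublocale matching_pair "adj A\<^sub>1" "adj A\<^sub>2"
  unfolding matching_pair_def
  using triangle_free_2_matching_adj_iff[OF simple] subset_edges A\<^sub>1 A\<^sub>2 by simp

lemma coloured_UNIV: "coloured UNIV = sym_diff A\<^sub>1 A\<^sub>2"
proof -
  have "\<exists>x y. e = {x, y}" if "e \<in> sym_diff A\<^sub>1 A\<^sub>2" for e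
    using that subset_edges simple unfolding simple_graph_def by blast
  then show ?thesis unfolding coloured_def exclusive_adj by fast
qed

lemma finite_coloured: "finite (coloured UNIV)"
  using subset_edges unfolding coloured_UNIV
  by (intro finite_subset[OF _ simple_graph_finite[OF simple]]) blast

lemma sym_diff_if_switch:
  assumes "A \<subseteq> E" "P \<subseteq> E" "triangle_free_2_matching (switch P (adj A))"
  shows "two_matching V E (sym_diff A P) \<and> triangle_free (sym_diff A P)"
proof -
  have "sym_diff A P \<subseteq> E" using assms(1,2) by blast
  then show ?thesis
    using assms(3) triangle_free_2_matching_adj_iff[OF simple] unfolding switch_adj by metis
qed

lemma alternating_trail_if_transition_walk:
  assumes q: "transition_system q" and us: "transition_walk q us" "distinct (walk_edges us)"
    and coloured: "set (walk_edges us) \<subseteq> sym_diff A\<^sub>1 A\<^sub>2" "set (walk_edges us) \<noteq> {}"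
  shows "alternating_trail E A\<^sub>1 A\<^sub>2 us"
  unfolding alternating_trail_def is_trail_def
proof (intro conjI allI impI)
  show "2 \<le> length us" using coloured(2) by (auto elim: walk_edges_nonemptyE)
  show "set (walk_edges us) \<subseteq> E" using coloured(1) subset_edges by blast
  fix i assume "Suc i < length (walk_edges us)"
  then have i: "Suc (Suc i) < length us" by (simp add: length_walk_edges)
  then have "opposite (us ! Suc i) (us ! i) (us ! Suc (Suc i))"
    using transition_opposite[OF transition_systemD[OF q]] transition_walk_nth[OF us(1)] by blast
  moreover have "walk_edges us ! i = {us ! Suc i, us ! i}"
    "walk_edges us ! Suc i = {us ! Suc i, us ! Suc (Suc i)}"
    using nth_walk_edges[of i us] nth_walk_edges[of "Suc i" us] i by auto
  ultimately show "walk_edges us ! i \<in> A\<^sub>1 - A\<^sub>2 \<and> walk_edges us ! Suc i \<in> A\<^sub>2 - A\<^sub>1 \<or>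
      walk_edges us ! i \<in> A\<^sub>2 - A\<^sub>1 \<and> walk_edges us ! Suc i \<in> A\<^sub>1 - A\<^sub>2"
    unfolding opposite_def exclusive_adj by simp
qed (use us(2) coloured(1) in simp_all)

end

theorem theorem1:
  fixes V :: "'a set" and E A\<^sub>1 A\<^sub>2 :: "'a set set"
  assumes "simple_graph V E"
    and "two_matching V E A\<^sub>1" and "triangle_free A\<^sub>1"
    and "two_matching V E A\<^sub>2" and "triangle_free A\<^sub>2"
  shows "\<exists>\<P>. partition_on (sym_diff A\<^sub>1 A\<^sub>2) \<P> \<and>
           (\<forall>P\<in>\<P>. (\<exists>us. alternating_trail E A\<^sub>1 A\<^sub>2 us \<and> P = set (walk_edges us)) \<and>
              (\<forall>A\<in>{A\<^sub>1, A\<^sub>2}. two_matching V E (sym_diff A P) \<and> triangle_free (sym_diff A P)))"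
proof -
  interpret triangle_free_matchings V E A\<^sub>1 A\<^sub>2 using assms by unfold_locales
  obtain q \<P> where q: "transition_system q" and \<P>: "partition_on (sym_diff A\<^sub>1 A\<^sub>2) \<P>"
    and trail: "\<forall>P\<in>\<P>. \<exists>us. transition_walk q us \<and> distinct (walk_edges us) \<and>
      set (walk_edges us) = P"
    and switch: "\<forall>P\<in>\<P>. triangle_free_2_matching (switch P (adj A\<^sub>1)) \<and>
      triangle_free_2_matching (switch P (adj A\<^sub>2))"
    by (rule trail_partition[OF finite_coloured, unfolded coloured_UNIV])
  have "(\<exists>us. alternating_trail E A\<^sub>1 A\<^sub>2 us \<and> P = set (walk_edges us)) \<and>
      (\<forall>A\<in>{A\<^sub>1, A\<^sub>2}. two_matching V E (sym_diff A P) \<and> triangle_free (sym_diff A P))"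
    if P: "P \<in> \<P>" for P
  proof
    have sub: "P \<subseteq> sym_diff A\<^sub>1 A\<^sub>2" "P \<noteq> {}" using \<P> P unfolding partition_on_def by auto
    obtain us where us: "transition_walk q us" "distinct (walk_edges us)"
      and P_eq: "P = set (walk_edges us)"
      using bspec[OF trail P] by blast
    have "alternating_trail E A\<^sub>1 A\<^sub>2 us"
      using q us sub unfolding P_eq by (rule alternating_trail_if_transition_walk)
    then show "\<exists>us. alternating_trail E A\<^sub>1 A\<^sub>2 us \<and> P = set (walk_edges us)" using P_eq by metis
    have "P \<subseteq> E" using sub(1) subset_edges by blast
    then show "\<forall>A\<in>{A\<^sub>1, A\<^sub>2}. two_matching V E (sym_diff A P) \<and> triangle_free (sym_diff A P)"
      using sym_diff_if_switch subset_edges bspec[OF switch P] by simp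
  qed
  then show ?thesis using \<P> by (intro exI[of _ \<P>]) simp
qed

end
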